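(* Let $I\subset\mathbb{R}$ be an open interval and let $f=(f_n)_{n\ge1}$ be a family of strictly positive, increasing $C^1$ functions on $I$ such that $f_n(x)>1$ and $f_n'(x)>1$ for all $x\in I$ and all $n\ge1$. Let $y=(y_n)_{n\ge1}$ be an arbitrary sequence of real numbers in $[0,1]$. Assume: (i) $\displaystyle\lim_{r\to0}\ \limsup_{n\to\infty}\ \sup_{x,y'\in I,\ |x-y'|<r}\frac{\log f_n'(x)}{\log f_n'(y')}=1$; (ii) for all $v\in I$, $\displaystyle M:=\sup_{n\ge1}\frac{\log f_{n+1}'(v)}{\log f_n'(v)}<\infty$; (iii) for all $x\in I$ and all $\epsilon>0$, $\displaystyle\sum_{n=1}^\infty f_n'(x)^{-\epsilon}<\infty$. For $\tau>1$ define \[ E(f,y,\tau):=\{x\in I:\ \|f_n(x)-y_n\|<f_n(x)^{-\tau}\ \text{for infinitely many } n\}, \] and for $v\in I$ define \[ u(v):=\limsup_{n\to\infty}\frac{\log f_n(v)}{\log f_n'(v)},\qquad \ell(v):=\liminf_{n\to\infty}\frac{\log f_n(v)}{\log f_n'(v)}. \] Then for any $v\in I$ and any $\tau>1$, \[ \frac{1}{1+\tau u(v)}\le \lim_{\epsilon\to0}\dim_H\big([v-\epsilon,v+\epsilon]\cap E(f,y,\tau)\big)\le\frac{1}{1+\tau\ell(v)}. \] Moreover, if all the functions $f_n$ are linear (i.e. of the form $f_n(x)=a_nx+b_n$), then the same conclusion holds without assuming (ii), and in that case in fact \[ \lim_{\epsilon\to0}\dim_H\big([v-\epsilon,v+\epsilon]\cap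 E(f,y,\tau)\big)=\frac{1}{1+\tau\ell(v)}. \]
   Context: $\|t\|$ denotes the distance from a real number $t$ to the nearest integer, and $\dim_H$ denotes Hausdorff dimension. *)

theory Defs
  imports "HOL-Analysis.Analysis"
begin

section \<open>Hausdorff measure and Hausdorff dimension\<close>

text \<open>
  The convention at \<open>s = 0\<close> has to be spelled out, because \<open>0 powr 0 = 0\<close> in HOL, whereas
  a one-point set must contribute 1 to the zero-dimensional measure.
\<close>

definition diameter_pow :: "real \<Rightarrow> 'a::metric_space set \<Rightarrow> ennreal" where
  "diameter_pow s U =
     (if U = {} then 0 else if s = 0 then 1 else ennreal (diameter U powr s))"

text \<open>
  Covering sets are required to be bounded because \<^const>\<open>diameter\<close> is only meaningful
  for bounded sets.  Finite covers are included, as the sets may be empty.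
\<close>

definition hausdorff_premeasure :: "real \<Rightarrow> real \<Rightarrow> 'a::metric_space set \<Rightarrow> ennreal" where
  "hausdorff_premeasure s \<delta> A =
     (INF U \<in> {U :: nat \<Rightarrow> 'a set. A \<subseteq> (\<Union>i. U i) \<and> (\<forall>i. bounded (U i) \<and> diameter (U i) \<le> \<delta>)}.
        (\<Sum>i. diameter_pow s (U i)))"

definition hausdorff_measure :: "real \<Rightarrow> 'a::metric_space set \<Rightarrow> ennreal" where
  "hausdorff_measure s A = (SUP \<delta>\<in>{0<..}. hausdorff_premeasure s \<delta> A)"

definition hausdorff_dim :: "'a::metric_space set \<Rightarrow> ereal" where
  "hausdorff_dim A = Inf {ereal s | s. 0 \<le> s \<and> hausdorff_measure s A = 0}"


section \<open>Inhomogeneous approximation along a family of functions\<close>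

text \<open>
  Families and sequences are indexed by the positive integers; the value at index 0 is never
  relevant.
\<close>

definition dist_nearest_int :: "real \<Rightarrow> real" where
  "dist_nearest_int t = \<bar>t - of_int (round t)\<bar>"

definition inhom_approx_set ::
    "real set \<Rightarrow> (nat \<Rightarrow> real \<Rightarrow> real) \<Rightarrow> (nat \<Rightarrow> real) \<Rightarrow> real \<Rightarrow> real set" where
  "inhom_approx_set I f y \<tau> =
     {x \<in> I. infinite {n. 1 \<le> n \<and> dist_nearest_int (f n x - y n) < f n x powr (- \<tau>)}}"

text \<open>
  These two exponents may be infinite, so they live in the extended reals, where
  \<open>1 / \<infinity> = 0\<close>.
\<close>

definition upper_exponent :: "(nat \<Rightarrow> real \<Rightarrow> real) \<Rightarrow> real \<Rightarrow> ereal" where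
  "upper_exponent f v = limsup (\<lambda>n. ereal (ln (f n v) / ln (deriv (f n) v)))"

definition lower_exponent :: "(nat \<Rightarrow> real \<Rightarrow> real) \<Rightarrow> real \<Rightarrow> ereal" where
  "lower_exponent f v = liminf (\<lambda>n. ereal (ln (f n v) / ln (deriv (f n) v)))"

end

theory Submission
  imports Defs
begin

text \<open>
  In all cases the local dimension equals \<open>1 / (1 + \<tau> \<ell>(v))\<close>, which dominates the lower bound
  because \<open>\<ell>(v) \<le> u(v)\<close>.  Put \<open>q\<^sub>n = f\<^sub>n'(v)\<close>.  By (i), near \<open>v\<close> the derivative of \<open>f\<^sub>n\<close> lies between
  \<open>q\<^sub>n powr (1 - \<delta>)\<close> and \<open>q\<^sub>n powr (1 + \<delta>)\<close>, and since \<open>f\<^sub>n > 0\<close> slightly to the left this forces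
  \<open>f\<^sub>n\<close> to be constant up to a factor \<open>q\<^sub>n powr (3 * \<delta>)\<close>.

  The upper bound is the obvious cover by about \<open>q\<^sub>n\<close> intervals of length about
  \<open>f\<^sub>n(v) powr (-\<tau>) / q\<^sub>n\<close>; condition (iii) makes the Hausdorff sums converge.

  For the lower bound, pass to the indices along which \<open>ln f\<^sub>n(v) / ln q\<^sub>n\<close> approaches its lower
  limit.  Given a cover by sets of diameter at most \<open>d\<^sub>i > 0\<close>, choose nested intervals \<open>J\<close> inside successive
  approximation sets for which the sum of \<open>d\<^sub>i powr s\<close> over the sets that meet \<open>J\<close> is at most
  \<open>\<bar>J\<bar> powr s / 2\<close>.  Averaging over the many candidates inside \<open>J\<close> yields the next interval.
  As \<open>\<bar>J\<bar>\<close> tends to 0 while the \<open>d\<^sub>i\<close> are fixed, no set of the cover contains the limit point.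
\<close>

section \<open>Bounds for the Hausdorff dimension\<close>

lemma hausdorff_dim_le:
  "0 \<le> s \<Longrightarrow> hausdorff_measure s A = 0 \<Longrightarrow> hausdorff_dim A \<le> ereal s"
  unfolding hausdorff_dim_def by (rule Inf_lower) auto

lemma hausdorff_premeasure_mono:
  "A \<subseteq> B \<Longrightarrow> hausdorff_premeasure s \<delta> A \<le> hausdorff_premeasure s \<delta> B"
  unfolding hausdorff_premeasure_def by (rule INF_superset_mono) auto

lemma hausdorff_measure_mono:
  "A \<subseteq> B \<Longrightarrow> hausdorff_measure s A \<le> hausdorff_measure s B"
  unfolding hausdorff_measure_def
  by (rule SUP_mono) (auto intro: hausdorff_premeasure_mono)

lemma hausdorff_dim_mono:
  assumes "A \<subseteq> B"
  shows "hausdorff_dim A \<le> hausdorff_dim B"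
  unfolding hausdorff_dim_def
proof (rule Inf_superset_mono, clarify)
  fix s assume "0 \<le> s" "hausdorff_measure s B = 0"
  with hausdorff_measure_mono[OF assms, of s]
  show "\<exists>s'. ereal s = ereal s' \<and> 0 \<le> s' \<and> hausdorff_measure s' A = 0"
    by auto
qed

section \<open>Upper bounds: covering a limsup set by its late levels\<close>

lemma diameter_pow_pos:
  "0 < s \<Longrightarrow> diameter_pow s U = ennreal (diameter U powr s)"
  by (simp add: diameter_pow_def)

text \<open>Every point of \<open>A\<close> lies in sets of arbitrarily late levels, so the levels
  from any \<open>N\<close> on still cover \<open>A\<close>, and their total cost is at most a tail
  of the convergent series.\<close>

lemma hausdorff_measure_limsup_null:
  fixes A :: "'a::metric_space set" and V :: "nat \<Rightarrow> nat \<Rightarrow> 'a set" and m :: "nat \<Rightarrow> nat"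
  assumes s: "0 < s"
    and cover: "\<And>x. x \<in> A \<Longrightarrow> infinite {n. \<exists>k<m n. x \<in> V n k}"
    and small: "\<forall>\<^sub>F n in sequentially. \<forall>k<m n. bounded (V n k) \<and> diameter (V n k) \<le> d n"
    and sum: "summable (\<lambda>n. real (m n) * d n powr s)"
  shows "hausdorff_measure s A = 0"
proof -
  \<comment> \<open>The summand 0 matches the shape of \<open>ennreal_le_epsilon\<close>, which
    later removes the arbitrary \<open>e\<close>.\<close>
  have "hausdorff_premeasure s \<delta> A \<le> 0 + ennreal e" if \<delta>: "0 < \<delta>" and e: "0 < e" for \<delta> e
  proof -
    define g where "g n = real (m n) * d n powr s" for n
    have "g \<longlonglongrightarrow> 0"
      using summable_LIMSEQ_zero[OF sum] by (simp add: g_def[abs_def])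
    then have "\<forall>\<^sub>F n in sequentially. g n < \<delta> powr s"
      using \<delta> by (intro order_tendstoD) auto
    then obtain N1 where N1: "\<And>n. n \<ge> N1 \<Longrightarrow> g n < \<delta> powr s"
      by (auto simp: eventually_sequentially)
    obtain N2 where N2: "\<And>n k. n \<ge> N2 \<Longrightarrow> k < m n \<Longrightarrow> bounded (V n k) \<and> diameter (V n k) \<le> d n"
      using small by (auto simp: eventually_sequentially)
    obtain N3 where N3: "\<And>n. n \<ge> N3 \<Longrightarrow> norm (\<Sum>i. g (i + n)) < e"
      using suminf_exist_split[OF e, of g] sum by (auto simp: g_def[abs_def])
    define N where "N = max N1 (max N2 N3)"
    have g0: "0 \<le> g n" for n by (simp add: g_def)
    have sumN: "summable (\<lambda>n. g (n + N))"
      using sum summable_ignore_initial_segment[of g N] by (simp add: g_def[abs_def])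
    \<comment> \<open>A level that contains a set at all has \<open>m n\<close> at least 1, so
      \<open>d n powr s\<close> is at most the term \<open>g n\<close>. Convergence of the series
      therefore also makes the diameters small.\<close>
    have dN: "diameter (V n k) \<le> \<delta>" if n: "n \<ge> N" and k: "k < m n" for n k
    proof -
      have "d n powr s \<le> g n"
        using k by (simp add: g_def mult_le_cancel_right1)
      also have "\<dots> < \<delta> powr s" using N1 n by (simp add: N_def)
      finally have "d n < \<delta>"
        using s \<delta> powr_mono2[of s \<delta> "d n"] by (cases "d n < \<delta>") auto
      then show ?thesis using N2[of n k] n k by (simp add: N_def)
    qed
    define W where "W = (\<lambda>(n, k). if k < m (n + N) then V (n + N) k else {})"
    define U where "U i = W (prod_decode i)" for i
    have "A \<subseteq> (\<Union>i. U i)"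
    proof
      fix x assume "x \<in> A"
      from cover[OF this] obtain n where "n \<ge> N" "\<exists>k<m n. x \<in> V n k"
        unfolding infinite_nat_iff_unbounded_le by blast
      then obtain k where "k < m n" "x \<in> V n k" by blast
      with \<open>n \<ge> N\<close> have "x \<in> U (prod_encode (n - N, k))"
        by (simp add: U_def W_def)
      then show "x \<in> (\<Union>i. U i)" by blast
    qed
    moreover have "bounded (U i) \<and> diameter (U i) \<le> \<delta>" for i
    proof -
      obtain n k where nk: "prod_decode i = (n, k)" by fastforce
      show ?thesis
        using dN[of "n + N" k] N2[of "n + N" k] \<delta> by (auto simp: U_def W_def nk N_def)
    qed
    ultimately have "hausdorff_premeasure s \<delta> A \<le> (\<Sum>i. diameter_pow s (U i))"
      unfolding hausdorff_premeasure_def by (intro INF_lower) auto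
    also have "\<dots> = (\<Sum>n. \<Sum>k. diameter_pow s (W (n, k)))"
      using suminf_ennreal_2dimen[of "\<lambda>n. \<Sum>k. diameter_pow s (W (n, k))" "\<lambda>p. diameter_pow s (W p)"]
      by (simp add: U_def o_def)
    also have "\<dots> \<le> (\<Sum>n. ennreal (g (n + N)))"
    proof (rule suminf_le)
      fix n
      have "(\<Sum>k. diameter_pow s (W (n, k))) = (\<Sum>k<m (n + N). diameter_pow s (W (n, k)))"
        by (rule suminf_finite) (auto simp: W_def diameter_pow_def)
      also have "\<dots> \<le> (\<Sum>k<m (n + N). ennreal (d (n + N) powr s))"
      proof (rule sum_mono)
        fix k assume "k \<in> {..<m (n + N)}"
        then have k: "k < m (n + N)" by simp
        then have "diameter (V (n + N) k) \<le> d (n + N)" "bounded (V (n + N) k)"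
          using N2[of "n + N" k] by (auto simp: N_def)
        then show "diameter_pow s (W (n, k)) \<le> ennreal (d (n + N) powr s)"
          using s k by (auto simp: W_def diameter_pow_pos intro!: ennreal_leI powr_mono2 diameter_ge_0)
      qed
      also have "\<dots> = ennreal (g (n + N))"
        by (simp add: g_def ennreal_mult ennreal_of_nat_eq_real_of_nat)
      finally show "(\<Sum>k. diameter_pow s (W (n, k))) \<le> ennreal (g (n + N))" .
    qed auto
    also have "\<dots> = ennreal (\<Sum>n. g (n + N))"
      by (rule suminf_ennreal2) (use g0 sumN in auto)
    also have "\<dots> \<le> 0 + ennreal e"
    proof -
      have "N3 \<le> N" by (simp add: N_def)
      then have "(\<Sum>n. g (n + N)) \<le> e" using N3[of N] by simp
      then show ?thesis by (simp add: ennreal_leI)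
    qed
    finally show ?thesis .
  qed
  then have "hausdorff_premeasure s \<delta> A = 0" if "0 < \<delta>" for \<delta>
    using that by (metis ennreal_le_epsilon le_zero_eq)
  then show ?thesis
    unfolding hausdorff_measure_def by simp
qed

section \<open>Lower bounds: nested intervals that avoid a cheap cover\<close>

lemma card_cells_hit:
  fixes U :: "real set" and a g d :: real and M :: nat
  assumes g: "0 < g" and d: "0 \<le> d"
    and diam: "\<And>x y. x \<in> U \<Longrightarrow> y \<in> U \<Longrightarrow> \<bar>x - y\<bar> \<le> d"
    and J: "\<And>j. j < M \<Longrightarrow> J j \<subseteq> {a + real j * g..a + real (Suc j) * g}"
  shows "real (card {j. j < M \<and> U \<inter> J j \<noteq> {}}) \<le> d / g + 2"
proof -
  define S where "S = {j. j < M \<and> U \<inter> J j \<noteq> {}}"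
  have fin: "finite S" by (simp add: S_def)
  show ?thesis
  proof (cases "S = {}")
    case True
    then show ?thesis using g d unfolding S_def[symmetric] by simp
  next
    case False
    define l h where "l = Min S" and "h = Max S"
    have lh: "l \<in> S" "h \<in> S" "l \<le> h" "S \<subseteq> {l..h}"
      using fin False by (auto simp: l_def h_def)
    obtain x where x: "x \<in> U" "x \<in> J l" using lh by (auto simp: S_def)
    obtain z where z: "z \<in> U" "z \<in> J h" using lh by (auto simp: S_def)
    have "x \<le> a + real (Suc l) * g" using J[of l] lh x by (auto simp: S_def)
    moreover have "a + real h * g \<le> z" using J[of h] lh z by (auto simp: S_def)
    moreover have "\<bar>x - z\<bar> \<le> d" using diam x z by blast
    \<comment> \<open>The cells strictly between the first and the last cell hit are spanned by two
      points of \<open>U\<close>. The two end cells account for the \<open>+ 2\<close> in the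
      claim.\<close>
    ultimately have "(real h - real l - 1) * g \<le> d" by (simp add: algebra_simps)
    then have "real h - real l - 1 \<le> d / g" using g by (simp add: pos_le_divide_eq)
    moreover have "card S \<le> Suc h - l" using card_mono[OF _ lh(4)] by simp
    ultimately show ?thesis using lh(3) unfolding S_def[symmetric] by linarith
  qed
qed

text \<open>
  Truncating the weights at the target value \<open>r powr s / 2\<close> makes a cell that is hit by a single
  large set as costly as one that is hit by too many small ones, so that one averaging over the
  cells handles both.
\<close>

lemma exists_light_cell:
  fixes U :: "nat \<Rightarrow> real set" and d p :: "nat \<Rightarrow> real" and a b r s :: real and M :: nat
  defines "mass \<equiv> \<lambda>J. \<Sum>i. if U i \<inter> J \<noteq> {} then d i powr s else 0"
  assumes ab: "a < b" and s: "0 < s" "s \<le> 1" and r: "0 < r"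
    and d: "\<And>i. 0 < d i"
    and diam: "\<And>i x y. x \<in> U i \<Longrightarrow> y \<in> U i \<Longrightarrow> \<bar>x - y\<bar> \<le> d i"
    and sum: "summable (\<lambda>i. d i powr s)"
    and mass: "mass {a..b} \<le> (b - a) powr s / 2"
    and many: "4 * (b - a) powr s < real M * r powr s"
    and J: "\<And>j. j < M \<Longrightarrow>
      {p j..p j + r} \<subseteq> {a + real j * ((b - a) / real M)..a + real (Suc j) * ((b - a) / real M)}"
  shows "\<exists>j<M. mass {p j..p j + r} \<le> r powr s / 2"
proof (rule ccontr)
  assume "\<not> ?thesis"
  then have heavy: "r powr s / 2 < mass {p j..p j + r}" if "j < M" for j
    using that by force
  define \<theta> where "\<theta> = r powr s / 2"
  define \<rho> where "\<rho> = b - a"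
  define g where "g = \<rho> / real M"
  define w where "w i = (if U i \<inter> {a..b} \<noteq> {} then d i powr s else 0)" for i
  define h where "h i j = (if U i \<inter> {p j..p j + r} \<noteq> {} then min (d i powr s) \<theta> else 0)" for i j
  have M: "0 < M"
    using many by (cases M) (auto simp: not_less[symmetric])
  have \<rho>: "0 < \<rho>" and \<theta>: "0 < \<theta>" using ab r by (auto simp: \<rho>_def \<theta>_def)
  have g: "0 < g" using M \<rho> by (simp add: g_def)
  have summ_if: "summable (\<lambda>i. if P i then d i powr s else 0)" for P
    by (rule summable_comparison_test'[OF sum, of 0]) auto
  have summ_h: "summable (\<lambda>i. h i j)" for j
    by (rule summable_comparison_test'[OF sum, of 0]) (use \<theta> in \<open>auto simp: h_def\<close>)
  have h0: "0 \<le> h i j" for i j using \<theta> by (auto simp: h_def)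
  have sub: "{p j..p j + r} \<subseteq> {a..b}" if "j < M" for j
  proof -
    have "real (Suc j) * g \<le> real M * g"
      using that g by (intro mult_right_mono) auto
    also have "real M * g = b - a" using M by (simp add: g_def \<rho>_def)
    finally have "a + real (Suc j) * g \<le> b" by simp
    moreover have "a \<le> a + real j * g" using g by simp
    ultimately show ?thesis using J[OF that] unfolding g_def \<rho>_def by auto
  qed
  \<comment> \<open>Either a single set meeting the cell has weight at least \<open>\<theta>\<close>
    and contributes exactly \<open>\<theta>\<close> after truncation, or truncation changes nothing
    and the sum is the mass of a heavy cell.\<close>
  have cell: "\<theta> \<le> (\<Sum>i. h i j)" if j: "j < M" for j
  proof (cases "\<exists>i. U i \<inter> {p j..p j + r} \<noteq> {} \<and> \<theta> \<le> d i powr s")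
    case True
    then obtain i where "U i \<inter> {p j..p j + r} \<noteq> {}" "\<theta> \<le> d i powr s" by blast
    then have "h i j = \<theta>" by (simp add: h_def)
    then show ?thesis
      using sum_le_suminf[OF summ_h, of "{i}" j] h0 by simp
  next
    case False
    then have "(\<lambda>i. h i j) = (\<lambda>i. if U i \<inter> {p j..p j + r} \<noteq> {} then d i powr s else 0)"
      by (auto simp: h_def fun_eq_iff)
    then show ?thesis using heavy[OF j] by (simp add: mass_def \<theta>_def)
  qed
  have mass_w: "mass {a..b} = (\<Sum>i. w i)" by (simp add: mass_def w_def[abs_def])
  have summ_w: "summable w" unfolding w_def[abs_def] by (rule summ_if)
  have w0: "0 \<le> w i" for i by (simp add: w_def)
  \<comment> \<open>A set meets at most \<open>d i / g + 2\<close> cells. The first summand is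
    charged at rate \<open>\<theta>\<close> per cell, the two extra cells at the full weight
    \<open>d i powr s\<close>.\<close>
  have row: "(\<Sum>j<M. h i j) \<le> w i * (\<theta> * real M / \<rho> powr s + 2)" for i
  proof (cases "U i \<inter> {a..b} = {}")
    case True
    then have "h i j = 0" if "j < M" for j using sub[OF that] by (auto simp: h_def)
    then show ?thesis using True by (simp add: w_def)
  next
    case False
    \<comment> \<open>One weight is at most the whole mass of the interval, so \<open>d i\<close> is
      below its length. For a ratio below 1 the exponent \<open>s \<le> 1\<close> only increases it,
      which turns the linear count of cells into a bound in terms of
      \<open>d i powr s\<close>.\<close>
    have "d i powr s = w i" using False by (simp add: w_def)
    also have "\<dots> \<le> (\<Sum>i. w i)"
      using sum_le_suminf[OF summ_w, of "{i}"] w0 by simp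
    also have "\<dots> < \<rho> powr s"
    proof -
      have "0 < \<rho> powr s" using \<rho> by simp
      then show ?thesis using mass unfolding mass_w \<rho>_def[symmetric] by linarith
    qed
    finally have "d i < \<rho>"
      using s \<rho> powr_mono2[of s \<rho> "d i"] by (cases "d i < \<rho>") auto
    then have "(d i / \<rho>) powr 1 \<le> (d i / \<rho>) powr s"
      using s d[of i] \<rho> by (intro powr_mono') auto
    then have di: "d i / \<rho> \<le> d i powr s / \<rho> powr s"
      using d[of i] \<rho> by (simp add: powr_divide)
    have "(\<Sum>j<M. h i j) = (\<Sum>j\<in>{j. j < M \<and> U i \<inter> {p j..p j + r} \<noteq> {}}. min (d i powr s) \<theta>)"
      by (rule sum.mono_neutral_cong_right) (auto simp: h_def)
    also have "\<dots> = real (card {j. j < M \<and> U i \<inter> {p j..p j + r} \<noteq> {}}) * min (d i powr s) \<theta>"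
      by simp
    also have "\<dots> \<le> (d i / g + 2) * min (d i powr s) \<theta>"
      using d[of i] \<theta> diam J unfolding g_def \<rho>_def
      by (intro mult_right_mono card_cells_hit) (use ab M in \<open>auto intro: less_imp_le\<close>)
    also have "\<dots> = d i / g * min (d i powr s) \<theta> + 2 * min (d i powr s) \<theta>"
      by (simp add: algebra_simps)
    also have "\<dots> \<le> d i / g * \<theta> + 2 * d i powr s"
      using d[of i] g by (intro add_mono mult_left_mono) auto
    also have "d i / g = real M * (d i / \<rho>)" by (simp add: g_def)
    also have "real M * (d i / \<rho>) * \<theta> \<le> real M * (d i powr s / \<rho> powr s) * \<theta>"
      using di \<theta> by (intro mult_left_mono mult_right_mono) auto
    finally show ?thesis using False by (simp add: w_def algebra_simps)
  qed
  \<comment> \<open>Double counting: summed by cells the truncated weights give at least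
    \<open>\<theta> * real M\<close>; summed by sets they give at most half of that plus
    \<open>\<rho> powr s\<close>. The hypothesis \<open>many\<close> says exactly that
    \<open>\<rho> powr s\<close> is less than the other half.\<close>
  have "\<theta> * real M = (\<Sum>j<M. \<theta>)" by simp
  also have "\<dots> \<le> (\<Sum>j<M. \<Sum>i. h i j)" by (rule sum_mono) (use cell in auto)
  also have "\<dots> = (\<Sum>i. \<Sum>j<M. h i j)" by (rule suminf_sum[symmetric]) (rule summ_h)
  also have "\<dots> \<le> (\<Sum>i. w i * (\<theta> * real M / \<rho> powr s + 2))"
    by (rule suminf_le[OF row summable_sum summable_mult2]) (auto intro: summ_h summ_w)
  also have "\<dots> = (\<Sum>i. w i) * (\<theta> * real M / \<rho> powr s + 2)"
    by (rule suminf_mult2[symmetric, OF summ_w])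
  also have "\<dots> \<le> \<rho> powr s / 2 * (\<theta> * real M / \<rho> powr s + 2)"
    using mass \<theta> unfolding mass_w \<rho>_def by (intro mult_right_mono) auto
  also have "\<dots> = \<theta> * real M / 2 + \<rho> powr s"
    using \<rho> by (simp add: field_simps)
  also have "\<dots> < \<theta> * real M"
    using many by (simp add: \<theta>_def \<rho>_def field_simps)
  finally show False by simp
qed

text \<open>Repeated choice of light cells gives nested intervals inside sets \<open>A n\<close> of
  increasing index, whose mass stays below half the \<open>s\<close>-th power of their length. Their
  common point lies in infinitely many \<open>A n\<close> and escapes the cover.\<close>

lemma limsup_not_covered:
  fixes A U :: "nat \<Rightarrow> real set" and d :: "nat \<Rightarrow> real" and \<alpha> \<beta> s :: real
  assumes \<alpha>\<beta>: "\<alpha> < \<beta>" and s: "0 < s" "s \<le> 1"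
    and step: "\<And>a b N. \<alpha> \<le> a \<Longrightarrow> a < b \<Longrightarrow> b \<le> \<beta> \<Longrightarrow>
      \<exists>n\<ge>N. \<exists>M r p. 0 < r \<and> 4 * (b - a) powr s < real M * r powr s \<and>
        (\<forall>j<M. {p j..p j + r} \<subseteq>
          A n \<inter> {a + real j * ((b - a) / real M)..a + real (Suc j) * ((b - a) / real M)})"
    and d: "\<And>i. 0 < d i"
    and diam: "\<And>i x y. x \<in> U i \<Longrightarrow> y \<in> U i \<Longrightarrow> \<bar>x - y\<bar> \<le> d i"
    and sum: "summable (\<lambda>i. d i powr s)" "(\<Sum>i. d i powr s) \<le> (\<beta> - \<alpha>) powr s / 2"
  shows "\<exists>x\<in>{\<alpha>..\<beta>}. infinite {n. x \<in> A n} \<and> x \<notin> (\<Union>i. U i)"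
proof -
  define mass where "mass J = (\<Sum>i. if U i \<inter> J \<noteq> {} then d i powr s else 0)" for J
  define P where "P = (\<lambda>(a, b, n::nat). \<alpha> \<le> a \<and> a < b \<and> b \<le> \<beta> \<and> mass {a..b} \<le> (b - a) powr s / 2)"
  define Q where "Q = (\<lambda>(a, b, n::nat) (a', b', n'). a \<le> a' \<and> b' \<le> b \<and> b' - a' \<le> (b - a) / 2 \<and>
    n < n' \<and> {a'..b'} \<subseteq> A n')"
  have summ_if: "summable (\<lambda>i. if S i then d i powr s else 0)" for S
    by (rule summable_comparison_test'[OF sum(1), of 0]) auto
  have "mass {\<alpha>..\<beta>} \<le> (\<Sum>i. d i powr s)"
    unfolding mass_def by (intro suminf_le summ_if sum(1)) auto
  then have P0: "P (\<alpha>, \<beta>, 0)" using \<alpha>\<beta> sum(2) by (simp add: P_def)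
  have PQ: "\<exists>y. P y \<and> Q x y" if Px: "P x" for x
  proof -
    obtain a b n where x: "x = (a, b, n)" by (cases x)
    have ab: "\<alpha> \<le> a" "a < b" "b \<le> \<beta>" and m: "mass {a..b} \<le> (b - a) powr s / 2"
      using Px by (auto simp: P_def x)
    obtain n' M r p where n': "n' \<ge> Suc n" and r: "0 < r"
      and many: "4 * (b - a) powr s < real M * r powr s"
      and J: "\<And>j. j < M \<Longrightarrow> {p j..p j + r} \<subseteq>
          A n' \<inter> {a + real j * ((b - a) / real M)..a + real (Suc j) * ((b - a) / real M)}"
      using step[OF ab, of "Suc n"] by blast
    obtain j where j: "j < M" and mj: "mass {p j..p j + r} \<le> r powr s / 2"
      using exists_light_cell[OF ab(2) s r d diam sum(1) m[unfolded mass_def] many, where p = p] J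
      unfolding mass_def by blast
    have M: "0 < real M" using j by simp
    have in_cell: "p j \<in> {a + real j * ((b - a) / real M)..a + real (Suc j) * ((b - a) / real M)}"
      "p j + r \<in> {a + real j * ((b - a) / real M)..a + real (Suc j) * ((b - a) / real M)}"
      using J[OF j] r by force+
    have "r \<le> (b - a) / real M"
      using in_cell unfolding of_nat_Suc distrib_right by auto
    \<comment> \<open>A single cell would force \<open>r powr s\<close> to exceed four times
      \<open>(b - a) powr s\<close> although \<open>r\<close> is at most \<open>b - a\<close>. Hence
      there are at least two cells, and the length at least halves in each round.\<close>
    moreover have "M \<noteq> 1"
    proof
      assume "M = 1"
      then have "r powr s \<le> (b - a) powr s"
        using \<open>r \<le> (b - a) / real M\<close> r s by (intro powr_mono2) auto
      moreover have "4 * (b - a) powr s < r powr s" using many \<open>M = 1\<close> by simp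
      ultimately show False using powr_ge_zero[of "b - a" s] by linarith
    qed
    then have "2 \<le> real M" using j by simp
    then have "(b - a) / real M \<le> (b - a) / 2"
      using ab by (intro divide_left_mono) auto
    ultimately have r2: "r \<le> (b - a) / 2" by linarith
    have "real (Suc j) * ((b - a) / real M) \<le> real M * ((b - a) / real M)"
      using j ab by (intro mult_right_mono) auto
    also have "\<dots> = b - a" using M by simp
    finally have "p j + r \<le> b" using in_cell(2) by simp
    moreover have "a \<le> p j"
    proof -
      have "0 \<le> real j * ((b - a) / real M)" using ab by simp
      then show ?thesis using in_cell(1) by simp
    qed
    ultimately have "P (p j, p j + r, n')" "Q x (p j, p j + r, n')"
      using ab r r2 mj n' J[OF j] by (auto simp: P_def Q_def x)
    then show ?thesis by blast
  qed
  obtain F where PF: "\<And>k. P (F k)" and QF: "\<And>k. Q (F k) (F (Suc k))"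
    using dependent_nat_choice[of "\<lambda>_. P" "\<lambda>_. Q"] P0 PQ by blast
  define a b n where "a k = fst (F k)" and "b k = fst (snd (F k))" and "n k = snd (snd (F k))" for k
  have F: "F k = (a k, b k, n k)" for k by (simp add: a_def b_def n_def)
  have ab: "\<alpha> \<le> a k" "a k < b k" "b k \<le> \<beta>" "mass {a k..b k} \<le> (b k - a k) powr s / 2" for k
    using PF[of k] by (auto simp: F P_def)
  have nest: "a k \<le> a (Suc k)" "b (Suc k) \<le> b k" "b (Suc k) - a (Suc k) \<le> (b k - a k) / 2"
    "n k < n (Suc k)" "{a (Suc k)..b (Suc k)} \<subseteq> A (n (Suc k))" for k
    using QF[of k] by (auto simp: F Q_def)
  have "antimono (\<lambda>k. {a k..b k})"
    using nest(1,2) by (intro decseq_SucI) auto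
  then have "\<Inter>(range (\<lambda>k. {a k..b k})) \<noteq> {}"
    using ab(2) by (intro compact_nest) (auto simp: antimono_def less_imp_le)
  then obtain x where x: "\<And>k. x \<in> {a k..b k}" by blast
  have len: "b k - a k \<le> (\<beta> - \<alpha>) * (1 / 2) ^ k" for k
  proof (induction k)
    case 0
    then show ?case using ab[of 0] by simp
  next
    case (Suc k)
    then show ?case using nest(3)[of k] by simp
  qed
  have lim: "(\<lambda>k. ((\<beta> - \<alpha>) * (1 / 2) ^ k) powr s) \<longlonglongrightarrow> 0"
  proof (rule tendsto_zero_powrI)
    show "(\<lambda>k. (\<beta> - \<alpha>) * (1 / 2) ^ k) \<longlonglongrightarrow> 0"
      by (intro tendsto_mult_right_zero LIMSEQ_realpow_zero) auto
  qed (use s \<alpha>\<beta> in auto)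
  \<comment> \<open>A set containing \<open>x\<close> meets every nested interval, so its fixed
    positive weight would be bounded by masses that tend to 0.\<close>
  have "x \<notin> U i" for i
  proof
    assume xi: "x \<in> U i"
    have "d i powr s \<le> ((\<beta> - \<alpha>) * (1 / 2) ^ k) powr s" for k
    proof -
      have "(\<Sum>i\<in>{i}. if U i \<inter> {a k..b k} \<noteq> {} then d i powr s else 0) \<le> mass {a k..b k}"
        unfolding mass_def by (intro sum_le_suminf summ_if) auto
      then have "d i powr s \<le> mass {a k..b k}"
        using xi x[of k] by (auto split: if_splits)
      also have "\<dots> \<le> (b k - a k) powr s"
        using ab(4)[of k] powr_ge_zero[of "b k - a k" s] by linarith
      also have "\<dots> \<le> ((\<beta> - \<alpha>) * (1 / 2) ^ k) powr s"
        using s ab(2)[of k] len[of k] by (intro powr_mono2) auto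
      finally show ?thesis .
    qed
    then have "d i powr s \<le> 0" by (intro LIMSEQ_le_const[OF lim]) auto
    then show False using d[of i] by simp
  qed
  moreover have "infinite {n. x \<in> A n}"
  proof (rule infinite_super)
    have "strict_mono n" by (rule strict_monoI_Suc) (rule nest(4))
    then have "inj (\<lambda>k. n (Suc k))"
      by (auto simp: inj_on_def strict_mono_eq)
    then show "infinite (range (\<lambda>k. n (Suc k)))" by (rule range_inj_infinite)
    show "range (\<lambda>k. n (Suc k)) \<subseteq> {n. x \<in> A n}" using nest(5) x by blast
  qed
  moreover have "x \<in> {\<alpha>..\<beta>}" using x[of 0] ab[of 0] by auto
  ultimately show ?thesis by blast
qed

text \<open>If the dimension were below \<open>s\<close>, the limsup set would have measure zero for
  some exponent \<open>t < s\<close>, hence a cover of arbitrarily small cost, which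
  \<open>limsup_not_covered\<close> rules out.\<close>

lemma hausdorff_dim_limsup_ge:
  fixes A :: "nat \<Rightarrow> real set" and \<alpha> \<beta> s :: real
  assumes \<alpha>\<beta>: "\<alpha> < \<beta>" and s: "0 < s" "s \<le> 1"
    and step: "\<And>a b N. \<alpha> \<le> a \<Longrightarrow> a < b \<Longrightarrow> b \<le> \<beta> \<Longrightarrow>
      \<exists>n\<ge>N. \<exists>M r p. 0 < r \<and> 4 * (b - a) powr s < real M * r powr s \<and>
        (\<forall>j<M. {p j..p j + r} \<subseteq>
          A n \<inter> {a + real j * ((b - a) / real M)..a + real (Suc j) * ((b - a) / real M)})"
  shows "ereal s \<le> hausdorff_dim ({\<alpha>..\<beta>} \<inter> {x. infinite {n. x \<in> A n}})"
proof (rule ccontr)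
  define E where "E = {\<alpha>..\<beta>} \<inter> {x. infinite {n. x \<in> A n}}"
  assume "\<not> ?thesis"
  then obtain t where t: "0 \<le> t" "t < s" and null: "hausdorff_measure t E = 0"
    unfolding hausdorff_dim_def E_def[symmetric] not_le Inf_less_iff by auto
  \<comment> \<open>A quarter of the target: one \<open>\<kappa>\<close> pays for the cover and
    another for the padding of the weights, together half of
    \<open>(\<beta> - \<alpha>) powr s\<close>.\<close>
  define \<kappa> where "\<kappa> = (\<beta> - \<alpha>) powr s / 4"
  have \<kappa>: "0 < \<kappa>" using \<alpha>\<beta> by (simp add: \<kappa>_def)
  have "hausdorff_premeasure t 1 E \<le> hausdorff_measure t E"
    unfolding hausdorff_measure_def by (rule SUP_upper) auto
  then have "hausdorff_premeasure t 1 E < ennreal \<kappa>" using null \<kappa> by simp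
  then obtain U where U: "E \<subseteq> (\<Union>i. U i)" "\<And>i. bounded (U i)" "\<And>i. diameter (U i) \<le> 1"
    and Ut: "(\<Sum>i. diameter_pow t (U i)) < ennreal \<kappa>"
    unfolding hausdorff_premeasure_def by (auto simp: INF_less_iff)
  define w where "w i = diameter (U i) powr s" for i
  have w0: "0 \<le> w i" for i by (simp add: w_def)
  \<comment> \<open>Diameters are at most 1, so raising the exponent from \<open>t\<close> to
    \<open>s\<close> does not raise the cost. The bound by 1 handles \<open>t = 0\<close>, where
    every nonempty set costs 1.\<close>
  have le: "ennreal (w i) \<le> diameter_pow t (U i)" for i
  proof -
    have "w i \<le> 1"
      using powr_mono2[of s "diameter (U i)" 1] U s by (simp add: w_def diameter_ge_0)
    moreover have "w i \<le> diameter (U i) powr t"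
      unfolding w_def using U t by (intro powr_mono') (auto simp: diameter_ge_0)
    ultimately show ?thesis
      using s unfolding diameter_pow_def
      by (auto simp: w_def intro!: ennreal_leI simp flip: ennreal_1)
  qed
  have "(\<Sum>i. ennreal (w i)) \<le> (\<Sum>i. diameter_pow t (U i))"
    by (intro suminf_le le) auto
  then have sw: "(\<Sum>i. ennreal (w i)) < ennreal \<kappa>" using Ut by simp
  then have summ_w: "summable w"
    by (intro summable_suminf_not_top w0) auto
  have "ennreal (\<Sum>i. w i) < ennreal \<kappa>"
    using sw by (subst suminf_ennreal2[symmetric]) (auto intro: w0 summ_w)
  then have w_le: "(\<Sum>i. w i) \<le> \<kappa>" using \<kappa> by (simp add: ennreal_less_iff suminf_nonneg[OF summ_w w0])
  \<comment> \<open>Singletons have weight 0; the geometric term makes every weight positive.\<close>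
  define d where "d i = (w i + \<kappa> * (1 / 2) ^ Suc i) powr (1 / s)" for i
  have arg: "0 < w i + \<kappa> * (1 / 2) ^ Suc i" for i
    using w0[of i] \<kappa> by (intro add_nonneg_pos) auto
  have ds: "d i powr s = w i + \<kappa> * (1 / 2) ^ Suc i" for i
    using arg[of i] s by (simp add: d_def powr_powr)
  have "(\<lambda>i. w i + \<kappa> * (1 / 2) ^ Suc i) sums ((\<Sum>i. w i) + \<kappa> * 1)"
    by (intro sums_add sums_mult power_half_series summable_sums summ_w)
  then have sums: "(\<lambda>i. d i powr s) sums ((\<Sum>i. w i) + \<kappa>)" by (simp add: ds)
  have diam: "\<bar>x - y\<bar> \<le> d i" if "x \<in> U i" "y \<in> U i" for i x y
  proof -
    have "\<bar>x - y\<bar> \<le> diameter (U i)"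
      using diameter_bounded_bound[OF U(2) that] by (simp add: dist_real_def)
    also have "\<dots> = w i powr (1 / s)"
      using s by (simp add: w_def powr_powr diameter_ge_0 U)
    also have "\<dots> \<le> d i"
      unfolding d_def using s w0 \<kappa> by (intro powr_mono2) auto
    finally show ?thesis .
  qed
  have "\<exists>x\<in>{\<alpha>..\<beta>}. infinite {n. x \<in> A n} \<and> x \<notin> (\<Union>i. U i)"
  proof (rule limsup_not_covered[OF \<alpha>\<beta> s step, where d = d])
    show "0 < d i" for i using arg[of i] by (simp add: d_def)
    show "summable (\<lambda>i. d i powr s)" using sums by (rule sums_summable)
    have "(\<Sum>i. d i powr s) = (\<Sum>i. w i) + \<kappa>" using sums by (rule sums_unique[symmetric])
    then show "(\<Sum>i. d i powr s) \<le> (\<beta> - \<alpha>) powr s / 2"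
      using w_le by (simp add: \<kappa>_def)
  qed (use diam in auto)
  then show False using U(1) by (auto simp: E_def)
qed

section \<open>Approximation along an expanding family\<close>

lemma dist_nearest_int_le: "dist_nearest_int t \<le> \<bar>t - of_int k\<bar>"
  unfolding dist_nearest_int_def by (rule round_diff_minimal)

text \<open>The assumption \<open>distortion\<close> is condition (i) in epsilon form. It is
  symmetric in the two points, so the single upper bound controls the quotient of logarithms from
  both sides.\<close>

locale expanding_family =
  fixes I :: "real set" and f :: "nat \<Rightarrow> real \<Rightarrow> real"
  assumes open_I: "open I"
    and deriv: "\<And>n x. 1 \<le> n \<Longrightarrow> x \<in> I \<Longrightarrow> (f n has_real_derivative deriv (f n) x) (at x)"
    and f_gt_1: "\<And>n x. 1 \<le> n \<Longrightarrow> x \<in> I \<Longrightarrow> 1 < f n x"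
    and deriv_gt_1: "\<And>n x. 1 \<le> n \<Longrightarrow> x \<in> I \<Longrightarrow> 1 < deriv (f n) x"
    and distortion: "\<And>\<delta>. 0 < \<delta> \<Longrightarrow> \<exists>r>0. \<forall>\<^sub>F n in sequentially. \<forall>x\<in>I. \<forall>x'\<in>I.
      \<bar>x - x'\<bar> < r \<longrightarrow> ln (deriv (f n) x) / ln (deriv (f n) x') < 1 + \<delta>"
    and summable_deriv: "\<And>x \<epsilon>. x \<in> I \<Longrightarrow> 0 < \<epsilon> \<Longrightarrow> summable (\<lambda>n. deriv (f n) x powr (- \<epsilon>))"
begin

text \<open>The terms of a convergent series tend to 0, so every positive power of the derivative
  tends to infinity. This is what absorbs all constants later on.\<close>

lemma eventually_deriv_powr_ge:
  assumes "v \<in> I" "0 < \<delta>"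
  shows "\<forall>\<^sub>F n in sequentially. C \<le> deriv (f n) v powr \<delta>"
proof -
  define C' where "C' = max C 1"
  have "(\<lambda>n. deriv (f n) v powr (- \<delta>)) \<longlonglongrightarrow> 0"
    using summable_LIMSEQ_zero[OF summable_deriv[OF assms]] .
  then have "\<forall>\<^sub>F n in sequentially. deriv (f n) v powr (- \<delta>) < 1 / C'"
    by (rule order_tendstoD) (simp add: C'_def)
  then show ?thesis
    using eventually_ge_at_top[of 1]
  proof eventually_elim
    case (elim n)
    then have "0 < deriv (f n) v powr \<delta>" using deriv_gt_1[of n v] assms by simp
    then have "C' < deriv (f n) v powr \<delta>"
      using elim by (simp add: powr_minus C'_def field_simps)
    then show ?case by (simp add: C'_def)
  qed
qed

text \<open>Distortion makes all slopes near \<open>v\<close> comparable up to small powers of the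
  slope at \<open>v\<close>; the mean value theorem passes this to increments. Positivity of
  \<open>f n\<close> a little to the left then makes its values large compared with its variation,
  up to such powers.\<close>

lemma local_comparison:
  assumes v: "v \<in> I" and \<delta>: "0 < \<delta>" "\<delta> < 1"
  obtains \<epsilon> where "0 < \<epsilon>" "{v - \<epsilon>..v + \<epsilon>} \<subseteq> I"
    and "\<forall>\<^sub>F n in sequentially.
      (\<forall>a b. v - \<epsilon> \<le> a \<longrightarrow> a \<le> b \<longrightarrow> b \<le> v + \<epsilon> \<longrightarrow>
        deriv (f n) v powr (1 - \<delta>) * (b - a) \<le> f n b - f n a \<and>
        f n b - f n a \<le> deriv (f n) v powr (1 + \<delta>) * (b - a)) \<and>
      (\<forall>x\<in>{v - \<epsilon>..v + \<epsilon>}. f n v \<le> f n x * deriv (f n) v powr (3 * \<delta>) \<and>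
        f n x \<le> f n v * deriv (f n) v powr (3 * \<delta>))"
proof -
  obtain r where r: "0 < r" and dist: "\<forall>\<^sub>F n in sequentially. \<forall>x\<in>I. \<forall>x'\<in>I.
      \<bar>x - x'\<bar> < r \<longrightarrow> ln (deriv (f n) x) / ln (deriv (f n) x') < 1 + \<delta>"
    using distortion[OF \<delta>(1)] by blast
  obtain e where e: "0 < e" "cball v e \<subseteq> I"
    using open_I v open_contains_cball by blast
  \<comment> \<open>Slopes are controlled on the interval of twice this radius, because
    \<open>lower\<close> moves a further \<open>\<epsilon>\<close> to the left of a point of the
    smaller interval.\<close>
  define \<epsilon> where "\<epsilon> = min (e / 2) (r / 3)"
  have \<epsilon>: "0 < \<epsilon>" "2 * \<epsilon> \<le> e" "2 * \<epsilon> < r" using e r by (auto simp: \<epsilon>_def)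
  have K: "{v - 2 * \<epsilon>..v + 2 * \<epsilon>} \<subseteq> I"
    using e \<epsilon> by (auto simp: dist_real_def subset_iff)
  have "\<forall>\<^sub>F n in sequentially.
      (\<forall>a b. v - \<epsilon> \<le> a \<longrightarrow> a \<le> b \<longrightarrow> b \<le> v + \<epsilon> \<longrightarrow>
        deriv (f n) v powr (1 - \<delta>) * (b - a) \<le> f n b - f n a \<and>
        f n b - f n a \<le> deriv (f n) v powr (1 + \<delta>) * (b - a)) \<and>
      (\<forall>x\<in>{v - \<epsilon>..v + \<epsilon>}. f n v \<le> f n x * deriv (f n) v powr (3 * \<delta>) \<and>
        f n x \<le> f n v * deriv (f n) v powr (3 * \<delta>))"
    using dist eventually_ge_at_top[of 1] eventually_deriv_powr_ge[OF v \<delta>(1), of 2]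
  proof eventually_elim
    case (elim n)
    define q where "q = deriv (f n) v"
    have q: "1 < q" using deriv_gt_1 elim(2) v by (simp add: q_def)
    have bounds: "q powr (1 - \<delta>) \<le> deriv (f n) z \<and> deriv (f n) z \<le> q powr (1 + \<delta>)"
      if z: "z \<in> {v - 2 * \<epsilon>..v + 2 * \<epsilon>}" for z
    proof -
      have zI: "z \<in> I" and zr: "\<bar>z - v\<bar> < r" "\<bar>v - z\<bar> < r" using K z \<epsilon> by auto
      define t where "t = deriv (f n) z"
      have t: "1 < t" using deriv_gt_1 elim(2) zI by (simp add: t_def)
      have "ln t / ln q < 1 + \<delta>" "ln q / ln t < 1 + \<delta>"
        using elim(1) zI v zr by (auto simp: t_def q_def)
      then have up: "ln t < (1 + \<delta>) * ln q" and lo: "ln q < (1 + \<delta>) * ln t"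
        using q t by (auto simp: field_simps)
      \<comment> \<open>Since \<open>(1 - \<delta>) * (1 + \<delta>)\<close> is at most 1, the
        reversed distortion bound yields the exponent \<open>1 - \<delta>\<close>.\<close>
      have "(1 - \<delta>) * ln q \<le> (1 - \<delta>) * ((1 + \<delta>) * ln t)"
        using lo \<delta> by (intro mult_left_mono) auto
      also have "\<dots> = ln t - \<delta> * \<delta> * ln t" by (simp add: algebra_simps)
      also have "\<dots> \<le> ln t" using t \<delta> by simp
      finally have "exp ((1 - \<delta>) * ln q) \<le> exp (ln t)" by (simp only: exp_le_cancel_iff)
      moreover have "exp (ln t) \<le> exp ((1 + \<delta>) * ln q)" using up by simp
      ultimately show ?thesis using q t by (simp add: powr_def flip: t_def)
    qed
    have incr: "q powr (1 - \<delta>) * (b - a) \<le> f n b - f n a \<and> f n b - f n a \<le> q powr (1 + \<delta>) * (b - a)"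
      if ab: "v - 2 * \<epsilon> \<le> a" "a \<le> b" "b \<le> v + 2 * \<epsilon>" for a b
    proof (cases "a = b")
      case False
      then have "\<exists>z. a < z \<and> z < b \<and> f n b - f n a = (b - a) * deriv (f n) z"
        using ab K elim(2) by (intro MVT2 deriv) auto
      then obtain z where z: "a < z" "z < b" "f n b - f n a = deriv (f n) z * (b - a)"
        by (auto simp: mult.commute)
      then show ?thesis using bounds[of z] ab by (auto intro!: mult_right_mono)
    qed auto
    have lower: "\<epsilon> * q powr (1 - \<delta>) \<le> f n x" if x: "x \<in> {v - \<epsilon>..v + \<epsilon>}" for x
    proof -
      have "x - \<epsilon> \<in> I" using K x \<epsilon> by auto
      then have "1 < f n (x - \<epsilon>)" using f_gt_1 elim(2) by simp
      then show ?thesis using incr[of "x - \<epsilon>" x] x \<epsilon> by (simp add: mult.commute)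
    qed
    have close: "\<bar>f n x - f n v\<bar> \<le> q powr (1 + \<delta>) * \<epsilon>" if x: "x \<in> {v - \<epsilon>..v + \<epsilon>}" for x
    proof -
      have "\<bar>f n x - f n v\<bar> \<le> q powr (1 + \<delta>) * \<bar>x - v\<bar>"
      proof (cases "x \<le> v")
        case True
        then have "q powr (1 - \<delta>) * (v - x) \<le> f n v - f n x \<and> f n v - f n x \<le> q powr (1 + \<delta>) * (v - x)"
          using x \<epsilon> by (intro incr) auto
        moreover have "0 \<le> q powr (1 - \<delta>) * (v - x)" using True by simp
        moreover have e: "\<bar>x - v\<bar> = v - x" using True by simp
        ultimately show ?thesis unfolding e by linarith
      next
        case False
        then have "q powr (1 - \<delta>) * (x - v) \<le> f n x - f n v \<and> f n x - f n v \<le> q powr (1 + \<delta>) * (x - v)"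
          using x \<epsilon> by (intro incr) auto
        moreover have "0 \<le> q powr (1 - \<delta>) * (x - v)" using False by simp
        moreover have e: "\<bar>x - v\<bar> = x - v" using False by simp
        ultimately show ?thesis unfolding e by linarith
      qed
      also have "\<dots> \<le> q powr (1 + \<delta>) * \<epsilon>" using x by (intro mult_left_mono) auto
      finally show ?thesis .
    qed
    \<comment> \<open>The variation \<open>q powr (1 + \<delta>) * \<epsilon>\<close> is
      \<open>q powr (2 * \<delta>)\<close> times the bound of \<open>lower\<close>. The resulting
      factor \<open>1 + q powr (2 * \<delta>)\<close> fits into \<open>q powr (3 * \<delta>)\<close>
      because \<open>q powr \<delta>\<close> is at least 2.\<close>
    have comp: "f n x \<le> f n z * q powr (3 * \<delta>)"
      if "z \<in> {v - \<epsilon>..v + \<epsilon>}" "f n x \<le> f n z + q powr (1 + \<delta>) * \<epsilon>" for x z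
    proof -
      have "q powr (1 + \<delta>) * \<epsilon> = q powr (2 * \<delta>) * (\<epsilon> * q powr (1 - \<delta>))"
        by (simp add: powr_add[symmetric] add.commute)
      also have "\<dots> \<le> q powr (2 * \<delta>) * f n z"
        using lower that by (intro mult_left_mono) auto
      finally have "f n x \<le> f n z * (1 + q powr (2 * \<delta>))" using that by (simp add: algebra_simps)
      also have "\<dots> \<le> f n z * (q powr (2 * \<delta>) * q powr \<delta>)"
      proof (rule mult_left_mono)
        have "1 \<le> q powr (2 * \<delta>)" using q \<delta> by (simp add: ge_one_powr_ge_zero)
        moreover have "q powr (2 * \<delta>) * 2 \<le> q powr (2 * \<delta>) * q powr \<delta>"
          using elim(3) by (intro mult_left_mono) (auto simp: q_def)
        ultimately show "1 + q powr (2 * \<delta>) \<le> q powr (2 * \<delta>) * q powr \<delta>" by simp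
        have "0 \<le> \<epsilon> * q powr (1 - \<delta>)" using \<epsilon> by simp
        then show "0 \<le> f n z" using lower[OF that(1)] by linarith
      qed
      also have "q powr (2 * \<delta>) * q powr \<delta> = q powr (3 * \<delta>)"
        by (simp add: powr_add[symmetric])
      finally show ?thesis .
    qed
    have "f n v \<le> f n x * q powr (3 * \<delta>) \<and> f n x \<le> f n v * q powr (3 * \<delta>)"
      if "x \<in> {v - \<epsilon>..v + \<epsilon>}" for x
      using close[OF that] comp[OF that, of v] comp[of v x] \<epsilon> by auto
    then show ?case using incr \<epsilon> unfolding q_def by auto
  qed
  moreover have "{v - \<epsilon>..v + \<epsilon>} \<subseteq> I"
    using K \<epsilon>(1) by (auto simp: subset_iff)
  ultimately show ?thesis using that \<epsilon>(1) by blast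
qed

text \<open>Level \<open>n\<close> is covered by at most \<open>q n powr (1 + 2 * \<delta>)\<close>
  sets, one for each nearby integer, of diameter about
  \<open>q n powr (- (1 + \<tau> * \<sigma>))\<close> up to small powers. The assumption on
  \<open>s\<close> makes the cost a negative power of \<open>q n\<close>, summable by (iii).\<close>

lemma hausdorff_measure_inhom_approx_null:
  assumes v: "v \<in> I" and y: "\<And>n. 1 \<le> n \<Longrightarrow> y n \<in> {0..1}" and \<tau>: "0 < \<tau>" and s: "0 < s"
    and \<sigma>: "1 < s * (1 + \<tau> * \<sigma>)" "\<forall>\<^sub>F n in sequentially. deriv (f n) v powr \<sigma> \<le> f n v"
  shows "\<exists>\<epsilon>>0. hausdorff_measure s ({v - \<epsilon>..v + \<epsilon>} \<inter> inhom_approx_set I f y \<tau>) = 0"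
proof -
  \<comment> \<open>\<open>\<gamma>\<close> is the slack in the hypothesis and
    \<open>D * \<delta>\<close> the total loss from distortion. With \<open>\<delta>\<close> so
    small that the loss is below the slack, \<open>\<eta> = \<gamma> - D * \<delta>\<close> is
    positive.\<close>
  define \<gamma> where "\<gamma> = s * (1 + \<tau> * \<sigma>) - 1"
  define D where "D = 2 + s * (3 * \<tau> + 2)"
  define \<delta> where "\<delta> = min (1 / 2) (\<gamma> / (2 * D))"
  have \<gamma>: "0 < \<gamma>" and D: "0 < D" using \<sigma> s \<tau> by (auto simp: \<gamma>_def D_def intro: add_pos_pos)
  have \<delta>: "0 < \<delta>" "\<delta> < 1" using \<gamma> D by (auto simp: \<delta>_def)
  have "D * \<delta> \<le> D * (\<gamma> / (2 * D))" using D by (intro mult_left_mono) (auto simp: \<delta>_def)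
  also have "\<dots> < \<gamma>" using D \<gamma> by simp
  finally have D\<delta>: "D * \<delta> < \<gamma>" .
  define \<mu> where "\<mu> = \<sigma> - 3 * \<delta>"
  define \<eta> where "\<eta> = s * (\<tau> * \<mu> + 1 - 2 * \<delta>) - (1 + 2 * \<delta>)"
  have \<eta>: "0 < \<eta>" using D\<delta> by (simp add: \<eta>_def \<mu>_def \<gamma>_def D_def algebra_simps)
  obtain \<epsilon> where \<epsilon>: "0 < \<epsilon>" "{v - \<epsilon>..v + \<epsilon>} \<subseteq> I"
    and comp: "\<forall>\<^sub>F n in sequentially.
      (\<forall>a b. v - \<epsilon> \<le> a \<longrightarrow> a \<le> b \<longrightarrow> b \<le> v + \<epsilon> \<longrightarrow>
        deriv (f n) v powr (1 - \<delta>) * (b - a) \<le> f n b - f n a \<and>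
        f n b - f n a \<le> deriv (f n) v powr (1 + \<delta>) * (b - a)) \<and>
      (\<forall>x\<in>{v - \<epsilon>..v + \<epsilon>}. f n v \<le> f n x * deriv (f n) v powr (3 * \<delta>) \<and>
        f n x \<le> f n v * deriv (f n) v powr (3 * \<delta>))"
    by (rule local_comparison[OF v \<delta>])
  define J where "J = {v - \<epsilon>..v + \<epsilon>}"
  define q where "q n = deriv (f n) v" for n
  define m where "m n = nat \<lfloor>q n powr (1 + 2 * \<delta>)\<rfloor>" for n
  define d where "d n = q n powr (- (\<tau> * \<mu> + 1 - 2 * \<delta>))" for n
  \<comment> \<open>The index starts two below the floor at the left end: subtracting
    \<open>y n\<close>, at most 1, and rounding, at most 1/2, may bring the nearest integer below
    that floor.\<close>
  define V where "V n k = {x \<in> J. \<bar>f n x - y n - real_of_int (\<lfloor>f n (v - \<epsilon>)\<rfloor> - 2 + int k)\<bar> < f n x powr (- \<tau>)}"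
    for n k
  \<comment> \<open>The constant \<open>2 * \<epsilon> + 5\<close> absorbs the count of integers:
    \<open>2 * \<epsilon>\<close> for the length of \<open>J\<close>, 4 for rounding and offset, and
    1 for the strict inequality \<open>k < m n\<close>.\<close>
  define good where "good n \<longleftrightarrow> 1 \<le> n \<and> 1 < q n \<and> 2 * \<epsilon> + 5 \<le> q n powr \<delta> \<and>
      (\<forall>a b. v - \<epsilon> \<le> a \<longrightarrow> a \<le> b \<longrightarrow> b \<le> v + \<epsilon> \<longrightarrow>
        q n powr (1 - \<delta>) * (b - a) \<le> f n b - f n a \<and> f n b - f n a \<le> q n powr (1 + \<delta>) * (b - a)) \<and>
      (\<forall>x\<in>J. q n powr \<mu> \<le> f n x)" for n
  have good: "\<forall>\<^sub>F n in sequentially. good n"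
    using comp \<sigma>(2) eventually_ge_at_top[of 1] eventually_deriv_powr_ge[OF v \<delta>(1), of "2 * \<epsilon> + 5"]
  proof eventually_elim
    case (elim n)
    have q: "1 < q n" using deriv_gt_1 elim(3) v by (simp add: q_def)
    have "q n powr \<mu> \<le> f n x" if "x \<in> J" for x
    proof -
      have "q n powr \<sigma> \<le> f n x * q n powr (3 * \<delta>)"
        using elim(1,2) that unfolding J_def q_def by force
      then have "q n powr \<sigma> / q n powr (3 * \<delta>) \<le> f n x"
        using q by (simp add: pos_divide_le_eq)
      then show ?thesis by (simp add: \<mu>_def powr_diff)
    qed
    then show ?case using elim q unfolding good_def q_def by blast
  qed
  then obtain N where N: "\<And>n. n \<ge> N \<Longrightarrow> good n" by (auto simp: eventually_sequentially)
  have "hausdorff_measure s (J \<inter> inhom_approx_set I f y \<tau>) = 0"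
  proof (rule hausdorff_measure_limsup_null[OF s])
    fix x assume "x \<in> J \<inter> inhom_approx_set I f y \<tau>"
    then have x: "x \<in> J" and
      inf: "infinite {n. 1 \<le> n \<and> dist_nearest_int (f n x - y n) < f n x powr (- \<tau>)}"
      by (auto simp: inhom_approx_set_def)
    show "infinite {n. \<exists>k<m n. x \<in> V n k}"
    proof (rule infinite_super)
      show "infinite ({n. 1 \<le> n \<and> dist_nearest_int (f n x - y n) < f n x powr (- \<tau>)} - {..<N})"
        using inf by (rule Diff_infinite_finite[rotated]) simp
      show "{n. 1 \<le> n \<and> dist_nearest_int (f n x - y n) < f n x powr (- \<tau>)} - {..<N}
          \<subseteq> {n. \<exists>k<m n. x \<in> V n k}"
      proof
        fix n assume n: "n \<in> {n. 1 \<le> n \<and> dist_nearest_int (f n x - y n) < f n x powr (- \<tau>)} - {..<N}"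
        then have g: "good n" using N by auto
        define K where "K = round (f n x - y n)"
        define k where "k = nat (K - \<lfloor>f n (v - \<epsilon>)\<rfloor> + 2)"
        have yn: "0 \<le> y n" "y n \<le> 1" using y n by auto
        have r: "\<bar>of_int K - (f n x - y n)\<bar> \<le> 1 / 2" unfolding K_def by (rule of_int_round_abs_le)
        have xv: "v - \<epsilon> \<le> x" "x \<le> v + \<epsilon>" using x by (auto simp: J_def)
        have lo: "q n powr (1 - \<delta>) * (x - (v - \<epsilon>)) \<le> f n x - f n (v - \<epsilon>)"
          and up: "f n x - f n (v - \<epsilon>) \<le> q n powr (1 + \<delta>) * (x - (v - \<epsilon>))"
          using g xv unfolding good_def by blast+
        have "0 \<le> q n powr (1 - \<delta>) * (x - (v - \<epsilon>))" using xv by simp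
        then have "real_of_int \<lfloor>f n (v - \<epsilon>)\<rfloor> - 3 / 2 \<le> of_int K"
          using lo r yn of_int_floor_le[of "f n (v - \<epsilon>)"] by linarith
        then have k: "int k = K - \<lfloor>f n (v - \<epsilon>)\<rfloor> + 2" unfolding k_def by linarith
        have "q n powr (1 + \<delta>) * (x - (v - \<epsilon>)) \<le> q n powr (1 + \<delta>) * (2 * \<epsilon>)"
          using xv by (intro mult_left_mono) auto
        then have "real k \<le> q n powr (1 + \<delta>) * (2 * \<epsilon>) + 4"
          using k up r yn by linarith
        moreover have "1 \<le> q n powr (1 + \<delta>)"
          using g \<delta> by (intro ge_one_powr_ge_zero) (auto simp: good_def)
        moreover have "q n powr (1 + \<delta>) * (2 * \<epsilon> + 5) \<le> q n powr (1 + \<delta>) * q n powr \<delta>"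
          using g by (intro mult_left_mono) (auto simp: good_def)
        moreover have "q n powr (1 + \<delta>) * q n powr \<delta> = q n powr (1 + 2 * \<delta>)"
          by (simp add: powr_add[symmetric] add.commute)
        ultimately have "real k + 1 \<le> q n powr (1 + 2 * \<delta>)" by (simp add: algebra_simps)
        then have "k < m n" unfolding m_def by linarith
        moreover have "x \<in> V n k"
          using x n by (simp add: V_def k dist_nearest_int_def K_def)
        ultimately show "n \<in> {n. \<exists>k<m n. x \<in> V n k}" by blast
      qed
    qed
  next
    show "\<forall>\<^sub>F n in sequentially. \<forall>k<m n. bounded (V n k) \<and> diameter (V n k) \<le> d n"
      using good
    proof (eventually_elim, intro allI impI conjI)
      fix n k assume g: "good n"
      show "bounded (V n k)" by (rule bounded_subset[of J]) (auto simp: V_def J_def)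
      \<comment> \<open>Both values lie within their tolerances of the same number
        \<open>y n\<close> plus an integer. The factor 2 is absorbed by
        \<open>q n powr \<delta>\<close>, and division by the least slope gives
        \<open>d n\<close>.\<close>
      have ordered: "z - x \<le> d n" if "x \<in> V n k" "z \<in> V n k" "x \<le> z" for x z
      proof -
        have small: "f n t powr (- \<tau>) \<le> q n powr (- (\<tau> * \<mu>))" if "t \<in> V n k" for t
        proof -
          have "f n t powr (- \<tau>) \<le> (q n powr \<mu>) powr (- \<tau>)"
            using g that \<tau> by (intro powr_mono2') (auto simp: good_def V_def)
          then show ?thesis by (simp add: powr_powr mult.commute)
        qed
        have "q n powr (1 - \<delta>) * (z - x) \<le> f n z - f n x"
          using g that unfolding good_def V_def J_def by simp
        also have "\<dots> \<le> f n x powr (- \<tau>) + f n z powr (- \<tau>)"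
          using that(1,2) unfolding V_def by (auto simp: abs_if split: if_splits)
        also have "\<dots> \<le> 2 * q n powr (- (\<tau> * \<mu>))" using small[OF that(1)] small[OF that(2)] by simp
        also have "\<dots> \<le> q n powr \<delta> * q n powr (- (\<tau> * \<mu>))"
          using g \<epsilon> by (intro mult_right_mono) (auto simp: good_def)
        also have "\<dots> = q n powr (1 - \<delta>) * d n"
          by (simp add: d_def powr_add[symmetric])
        finally show ?thesis using g by (simp add: good_def)
      qed
      show "diameter (V n k) \<le> d n"
      proof (rule diameter_le)
        show "V n k \<noteq> {} \<or> 0 \<le> d n" by (simp add: d_def)
        fix x z assume "x \<in> V n k" "z \<in> V n k"
        then show "norm (x - z) \<le> d n"
          using ordered[of x z] ordered[of z x] by (cases "x \<le> z") auto
      qed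
    qed
  next
    show "summable (\<lambda>n. real (m n) * d n powr s)"
    proof (rule summable_comparison_test_ev)
      show "summable (\<lambda>n. q n powr (- \<eta>))"
        unfolding q_def using summable_deriv[OF v \<eta>] .
      show "\<forall>\<^sub>F n in sequentially. norm (real (m n) * d n powr s) \<le> q n powr (- \<eta>)"
        using good
      proof eventually_elim
        case (elim n)
        have "real (m n) * d n powr s \<le> q n powr (1 + 2 * \<delta>) * d n powr s"
          by (intro mult_right_mono) (auto simp: m_def)
        also have "\<dots> = q n powr (- \<eta>)"
          by (simp add: d_def powr_powr powr_add[symmetric] \<eta>_def algebra_simps)
        finally show ?case by simp
      qed
    qed
  qed
  then show ?thesis using \<epsilon> unfolding J_def by blast
qed

text \<open>Whenever \<open>f n v\<close> is small the tolerance is large. For such \<open>n\<close>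
  each of about \<open>q powr (1 - \<delta>)\<close> equal cells of a given interval contains an
  interval of length \<open>r\<close> of approximable points, and the bound on \<open>s\<close> lets
  \<open>real M * r powr s\<close> outgrow any constant.\<close>

lemma hausdorff_dim_inhom_approx_ge:
  assumes v: "v \<in> I" and \<tau>: "0 < \<tau>" and s: "0 < s" and \<epsilon>: "0 < \<epsilon>"
    and \<sigma>: "0 \<le> \<sigma>" "s * (1 + \<tau> * \<sigma>) < 1" "\<exists>\<^sub>F n in sequentially. f n v \<le> deriv (f n) v powr \<sigma>"
  shows "ereal s \<le> hausdorff_dim ({v - \<epsilon>..v + \<epsilon>} \<inter> inhom_approx_set I f y \<tau>)"
proof -
  \<comment> \<open>Again slack against loss: \<open>D\<close> is chosen so that
    \<open>D * \<delta> < \<gamma>\<close> is the inequality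
    \<open>s * \<kappa> < 1 - \<delta>\<close>, where \<open>q powr (- \<kappa>)\<close> is the
    scale of the intervals found below.\<close>
  define \<gamma> where "\<gamma> = 1 - s * (1 + \<tau> * \<sigma>)"
  define D where "D = 1 + s * (1 + 3 * \<tau>)"
  define \<delta> where "\<delta> = min (1 / 2) (\<gamma> / (2 * D))"
  have \<gamma>: "0 < \<gamma>" and D: "0 < D" using \<sigma> s \<tau> by (auto simp: \<gamma>_def D_def intro: add_pos_pos)
  have \<delta>: "0 < \<delta>" "\<delta> < 1" using \<gamma> D by (auto simp: \<delta>_def)
  have "D * \<delta> \<le> D * (\<gamma> / (2 * D))" using D by (intro mult_left_mono) (auto simp: \<delta>_def)
  also have "\<dots> < \<gamma>" using D \<gamma> by simp
  finally have D\<delta>: "D * \<delta> < \<gamma>" .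
  define \<kappa> where "\<kappa> = \<tau> * (\<sigma> + 3 * \<delta>) + 1 + \<delta>"
  have \<kappa>: "s * \<kappa> < 1 - \<delta>"
    using D\<delta> by (simp add: \<kappa>_def \<gamma>_def D_def algebra_simps)
  have "0 \<le> \<tau> * \<sigma>" using \<tau> \<sigma> by simp
  then have s1: "s \<le> 1" using \<sigma>(2) s mult_left_mono[of 1 "1 + \<tau> * \<sigma>" s] by linarith
  obtain \<epsilon>0 where \<epsilon>0: "0 < \<epsilon>0" "{v - \<epsilon>0..v + \<epsilon>0} \<subseteq> I"
    and comp: "\<forall>\<^sub>F n in sequentially.
      (\<forall>a b. v - \<epsilon>0 \<le> a \<longrightarrow> a \<le> b \<longrightarrow> b \<le> v + \<epsilon>0 \<longrightarrow>
        deriv (f n) v powr (1 - \<delta>) * (b - a) \<le> f n b - f n a \<and>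
        f n b - f n a \<le> deriv (f n) v powr (1 + \<delta>) * (b - a)) \<and>
      (\<forall>x\<in>{v - \<epsilon>0..v + \<epsilon>0}. f n v \<le> f n x * deriv (f n) v powr (3 * \<delta>) \<and>
        f n x \<le> f n v * deriv (f n) v powr (3 * \<delta>))"
    by (rule local_comparison[OF v \<delta>])
  define \<epsilon>1 where "\<epsilon>1 = min \<epsilon> \<epsilon>0"
  have \<epsilon>1: "0 < \<epsilon>1" "\<epsilon>1 \<le> \<epsilon>" "\<epsilon>1 \<le> \<epsilon>0" using \<epsilon> \<epsilon>0 by (auto simp: \<epsilon>1_def)
  define A where "A n = {x \<in> I. 1 \<le> n \<and> dist_nearest_int (f n x - y n) < f n x powr (- \<tau>)}" for n
  have "ereal s \<le> hausdorff_dim ({v - \<epsilon>1..v + \<epsilon>1} \<inter> {x. infinite {n. x \<in> A n}})"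
  proof (rule hausdorff_dim_limsup_ge[OF _ s s1])
    show "v - \<epsilon>1 < v + \<epsilon>1" using \<epsilon>1 by simp
    fix a b :: real and N :: nat
    assume ab: "v - \<epsilon>1 \<le> a" "a < b" "b \<le> v + \<epsilon>1"
    define \<rho> where "\<rho> = b - a"
    have \<rho>: "0 < \<rho>" using ab by (simp add: \<rho>_def)
    \<comment> \<open>This is the value for which
      \<open>C \<le> Q * q powr (- (s * \<kappa>))\<close> gives the required count, with
      \<open>M\<close> bounded below by \<open>\<rho> * Q / 8\<close>; the 1 makes the inequality
      strict.\<close>
    define C where "C = 32 * 2 powr s * \<rho> powr s / \<rho> + 1"
    have "\<forall>\<^sub>F n in sequentially. n \<ge> N \<and> n \<ge> 1 \<and> 8 / \<rho> \<le> deriv (f n) v powr (1 - \<delta>) \<and>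
        C \<le> deriv (f n) v powr (1 - \<delta> - s * \<kappa>) \<and>
        (\<forall>a b. v - \<epsilon>0 \<le> a \<longrightarrow> a \<le> b \<longrightarrow> b \<le> v + \<epsilon>0 \<longrightarrow>
          deriv (f n) v powr (1 - \<delta>) * (b - a) \<le> f n b - f n a \<and>
          f n b - f n a \<le> deriv (f n) v powr (1 + \<delta>) * (b - a)) \<and>
        (\<forall>x\<in>{v - \<epsilon>0..v + \<epsilon>0}. f n x \<le> f n v * deriv (f n) v powr (3 * \<delta>))"
      using \<delta> \<kappa> comp
      by (intro eventually_conj eventually_ge_at_top eventually_deriv_powr_ge v)
        (auto elim: eventually_mono)
    \<comment> \<open>Smallness of \<open>f n v\<close> holds only for infinitely many
      \<open>n\<close>, but every other requirement holds eventually, so some \<open>n\<close>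
      satisfies all of them.\<close>
    from frequently_eventually_frequently[OF \<sigma>(3) this]
    obtain n where n: "n \<ge> N" "n \<ge> 1" and q8: "8 / \<rho> \<le> deriv (f n) v powr (1 - \<delta>)"
      and qC: "C \<le> deriv (f n) v powr (1 - \<delta> - s * \<kappa>)"
      and incr: "\<And>a b. v - \<epsilon>0 \<le> a \<Longrightarrow> a \<le> b \<Longrightarrow> b \<le> v + \<epsilon>0 \<Longrightarrow>
          deriv (f n) v powr (1 - \<delta>) * (b - a) \<le> f n b - f n a \<and>
          f n b - f n a \<le> deriv (f n) v powr (1 + \<delta>) * (b - a)"
      and fx: "\<And>x. x \<in> {v - \<epsilon>0..v + \<epsilon>0} \<Longrightarrow> f n x \<le> f n v * deriv (f n) v powr (3 * \<delta>)"
      and fv: "f n v \<le> deriv (f n) v powr \<sigma>"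
      by (auto dest!: frequently_ex)
    define q where "q = deriv (f n) v"
    define Q where "Q = q powr (1 - \<delta>)"
    define r where "r = q powr (- \<kappa>) / 2"
    \<comment> \<open>Cells then have length at least \<open>4 / Q\<close>, so \<open>f n\<close>
      gains at least 2 on the left half of each. Since \<open>\<rho> * Q\<close> is at least 8, the
      floor loses at most half of \<open>\<rho> * Q / 4\<close>.\<close>
    define M where "M = nat \<lfloor>\<rho> * Q / 4\<rfloor>"
    define g where "g = \<rho> / real M"
    have q: "1 < q" using deriv_gt_1 n v by (simp add: q_def)
    have Q: "0 < Q" and r: "0 < r" using q by (auto simp: Q_def r_def)
    have "8 \<le> \<rho> * Q" using q8 \<rho> by (simp add: Q_def q_def field_simps)
    then have M: "\<rho> * Q / 8 \<le> real M" "real M \<le> \<rho> * Q / 4" "0 < M"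
      unfolding M_def by linarith+
    have gQ: "4 \<le> Q * g" using M by (simp add: g_def field_simps)
    have g: "0 < g" using M \<rho> by (simp add: g_def)
    have rg: "r \<le> g / 2"
    proof -
      have "q powr (- \<kappa>) \<le> q powr (- (1 - \<delta>))"
      proof (rule powr_mono)
        have "0 \<le> \<tau> * (\<sigma> + 3 * \<delta>)" using \<tau> \<sigma> \<delta> by simp
        then show "- \<kappa> \<le> - (1 - \<delta>)" using \<delta> by (simp add: \<kappa>_def)
      qed (use q in simp)
      also have "\<dots> = 1 / Q" by (simp add: Q_def powr_minus divide_inverse del: minus_diff_eq)
      also have "\<dots> \<le> g" using gQ Q by (simp add: field_simps)
      finally show ?thesis by (simp add: r_def)
    qed
    have "4 * \<rho> powr s < \<rho> * Q / 8 * r powr s"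
    proof -
      have "32 * 2 powr s * \<rho> powr s / \<rho> < q powr (1 - \<delta> - s * \<kappa>)"
        using qC by (simp add: C_def q_def)
      also have "\<dots> = Q * q powr (- (s * \<kappa>))" by (simp add: Q_def powr_add[symmetric])
      also have "q powr (- (s * \<kappa>)) = 2 powr s * r powr s"
        by (simp add: r_def powr_divide powr_powr mult.commute)
      finally show ?thesis using \<rho> by (simp add: field_simps)
    qed
    also have "\<dots> \<le> real M * r powr s" using M by (intro mult_right_mono) auto
    finally have many: "4 * (b - a) powr s < real M * r powr s" by (simp add: \<rho>_def)
    have "\<exists>x. {x..x + r} \<subseteq> A n \<inter> {a + real j * g..a + real (Suc j) * g}" if j: "j < M" for j
    proof -
      define c where "c = a + real j * g"
      have "real (Suc j) * g \<le> real M * g" using j g by (intro mult_right_mono) auto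
      also have "real M * g = b - a" using M by (simp add: g_def \<rho>_def)
      finally have cb: "c + g \<le> b" by (simp add: c_def algebra_simps)
      have "0 \<le> real j * g" using g by simp
      then have ac: "a \<le> c" by (simp add: c_def)
      have sub: "{c..c + g} \<subseteq> {v - \<epsilon>0..v + \<epsilon>0}" using ac cb ab \<epsilon>1 by auto
      \<comment> \<open>The value \<open>y n + of_int k\<close> lies less than 1 above
        \<open>f n c\<close>, apart from possible equality with \<open>f n c\<close>, so the
        intermediate value theorem attains it in the left half of the cell.\<close>
      define k where "k = \<lceil>f n c - y n\<rceil>"
      have "Q * g / 2 \<le> f n (c + g / 2) - f n c"
        using incr[of c "c + g / 2"] sub g by (simp add: Q_def q_def subset_iff)
      then have "f n c + 2 \<le> f n (c + g / 2)" using gQ by simp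
      moreover have "f n c - y n \<le> of_int k" "of_int k < f n c - y n + 1"
        unfolding k_def by linarith+
      moreover have "continuous_on {c..c + g / 2} (f n)"
      proof (rule DERIV_continuous_on)
        fix z assume z: "z \<in> {c..c + g / 2}"
        then have "z \<in> {c..c + g}" using g by auto
        then have "z \<in> I" using sub \<epsilon>0 by blast
        then show "(f n has_real_derivative deriv (f n) z) (at z within {c..c + g / 2})"
          using deriv n by (blast intro: has_field_derivative_at_within)
      qed
      ultimately have "\<exists>x\<ge>c. x \<le> c + g / 2 \<and> f n x = y n + of_int k"
        using g by (intro IVT') auto
      then obtain x where x: "c \<le> x" "x \<le> c + g / 2" "f n x = y n + of_int k" by blast
      \<comment> \<open>On an interval of length \<open>r\<close> the function moves by at most half
        of \<open>q powr (- (\<tau> * (\<sigma> + 3 * \<delta>)))\<close>, while the tolerance at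
        \<open>z\<close> is at least this power because \<open>f n z\<close> is at most
        \<open>q powr (\<sigma> + 3 * \<delta>)\<close>.\<close>
      have "z \<in> A n" if z: "z \<in> {x..x + r}" for z
      proof -
        have zc: "z \<in> {c..c + g}" using z x rg by auto
        then have zI: "z \<in> {v - \<epsilon>0..v + \<epsilon>0}" "z \<in> I" using sub \<epsilon>0 by blast+
        have xl: "v - \<epsilon>0 \<le> x" using x sub g by (auto simp: subset_iff)
        have "q powr (1 - \<delta>) * (z - x) \<le> f n z - f n x \<and> f n z - f n x \<le> q powr (1 + \<delta>) * (z - x)"
          using incr[of x z] xl z zI(1) by (simp add: q_def)
        moreover have "0 \<le> q powr (1 - \<delta>) * (z - x)" using z by simp
        ultimately have "\<bar>f n z - f n x\<bar> \<le> q powr (1 + \<delta>) * (z - x)" by linarith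
        also have "\<dots> \<le> q powr (1 + \<delta>) * r" using z by (intro mult_left_mono) auto
        also have "\<dots> = q powr (- (\<tau> * (\<sigma> + 3 * \<delta>))) / 2"
          by (simp add: r_def \<kappa>_def powr_add[symmetric])
        also have "\<dots> < q powr (- (\<tau> * (\<sigma> + 3 * \<delta>)))" using q by simp
        also have "\<dots> = (q powr (\<sigma> + 3 * \<delta>)) powr (- \<tau>)" by (simp add: powr_powr mult.commute)
        also have "\<dots> \<le> f n z powr (- \<tau>)"
        proof (rule powr_mono2')
          have "f n z \<le> f n v * q powr (3 * \<delta>)" using fx zI by (simp add: q_def)
          also have "\<dots> \<le> q powr \<sigma> * q powr (3 * \<delta>)"
            using fv by (intro mult_right_mono) (auto simp: q_def)
          finally show "f n z \<le> q powr (\<sigma> + 3 * \<delta>)" by (simp add: powr_add)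
          show "0 < f n z" using f_gt_1[OF n(2) zI(2)] by simp
        qed (use \<tau> in auto)
        finally have "\<bar>f n z - y n - of_int k\<bar> < f n z powr (- \<tau>)" using x by (simp add: algebra_simps)
        then have "dist_nearest_int (f n z - y n) < f n z powr (- \<tau>)"
          using dist_nearest_int_le[of "f n z - y n" k] by linarith
        then show ?thesis using zI n by (simp add: A_def)
      qed
      moreover have "{x..x + r} \<subseteq> {c..c + g}" using x rg by auto
      moreover have "c + g = a + real (Suc j) * g" by (simp add: c_def algebra_simps)
      ultimately show ?thesis unfolding c_def by (metis Int_subset_iff subsetI)
    qed
    then obtain p where "\<forall>j<M. {p j..p j + r} \<subseteq> A n \<inter> {a + real j * g..a + real (Suc j) * g}"
      by metis
    then show "\<exists>n\<ge>N. \<exists>M r p. 0 < r \<and> 4 * (b - a) powr s < real M * r powr s \<and>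
        (\<forall>j<M. {p j..p j + r} \<subseteq>
          A n \<inter> {a + real j * ((b - a) / real M)..a + real (Suc j) * ((b - a) / real M)})"
      using n(1) r many unfolding g_def \<rho>_def by blast
  qed
  also have "\<dots> \<le> hausdorff_dim ({v - \<epsilon>..v + \<epsilon>} \<inter> inhom_approx_set I f y \<tau>)"
  proof (rule hausdorff_dim_mono)
    show "{v - \<epsilon>1..v + \<epsilon>1} \<inter> {x. infinite {n. x \<in> A n}}
        \<subseteq> {v - \<epsilon>..v + \<epsilon>} \<inter> inhom_approx_set I f y \<tau>"
      using \<epsilon>1 by (auto simp: A_def inhom_approx_set_def)
  qed
  finally show ?thesis .
qed

section \<open>From the exponent of growth to the local dimension\<close>

lemma exponent_quotient_pos:
  "1 \<le> n \<Longrightarrow> v \<in> I \<Longrightarrow> 0 < ln (f n v) / ln (deriv (f n) v)"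
  using f_gt_1[of n v] deriv_gt_1[of n v] by simp

lemma lower_exponent_nonneg:
  assumes "v \<in> I"
  shows "0 \<le> lower_exponent f v"
  unfolding lower_exponent_def
proof (rule Liminf_bounded)
  show "\<forall>\<^sub>F n in sequentially. 0 \<le> ereal (ln (f n v) / ln (deriv (f n) v))"
    using eventually_ge_at_top[of 1]
    by eventually_elim (use exponent_quotient_pos assms in \<open>auto intro: less_imp_le\<close>)
qed

lemma le_exponent_quotient_iff:
  assumes "1 \<le> n" "v \<in> I"
  shows "\<sigma> \<le> ln (f n v) / ln (deriv (f n) v) \<longleftrightarrow> deriv (f n) v powr \<sigma> \<le> f n v"
proof -
  have "1 < f n v" "1 < deriv (f n) v" using f_gt_1 deriv_gt_1 assms by auto
  then have "deriv (f n) v powr \<sigma> \<le> f n v \<longleftrightarrow> ln (deriv (f n) v powr \<sigma>) \<le> ln (f n v)"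
    by (intro ln_le_cancel_iff[symmetric]) auto
  with \<open>1 < deriv (f n) v\<close> show ?thesis by (simp add: pos_le_divide_eq)
qed

lemma eventually_powr_le_if_less_lower_exponent:
  assumes v: "v \<in> I" and \<sigma>: "ereal \<sigma> < lower_exponent f v"
  shows "\<forall>\<^sub>F n in sequentially. deriv (f n) v powr \<sigma> \<le> f n v"
  using less_LiminfD[OF \<sigma>[unfolded lower_exponent_def]] eventually_ge_at_top[of 1]
proof eventually_elim
  case (elim n)
  then show ?case using le_exponent_quotient_iff[OF elim(2) v, of \<sigma>] by simp
qed

lemma frequently_le_powr_if_lower_exponent_less:
  assumes v: "v \<in> I" and \<sigma>: "lower_exponent f v < ereal \<sigma>"
  shows "\<exists>\<^sub>F n in sequentially. f n v \<le> deriv (f n) v powr \<sigma>"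
proof (rule ccontr)
  assume "\<not> ?thesis"
  then have "\<forall>\<^sub>F n in sequentially. \<not> f n v \<le> deriv (f n) v powr \<sigma>"
    by (simp add: not_frequently)
  then have "\<forall>\<^sub>F n in sequentially. ereal \<sigma> \<le> ereal (ln (f n v) / ln (deriv (f n) v))"
    using eventually_ge_at_top[of 1]
  proof eventually_elim
    case (elim n)
    then show ?case using le_exponent_quotient_iff[OF elim(2) v, of \<sigma>] by simp
  qed
  then have "ereal \<sigma> \<le> lower_exponent f v"
    unfolding lower_exponent_def by (rule Liminf_bounded)
  with \<sigma> show False by simp
qed

text \<open>For \<open>s\<close> below the claimed value some \<open>\<sigma>\<close> above the
  lower exponent still satisfies the condition of the lower estimate; for \<open>s\<close> above it
  some \<open>\<sigma>\<close> below the lower exponent satisfies that of the upper one.\<close>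

lemma local_dim_inhom_approx:
  assumes v: "v \<in> I" and y: "\<And>n. 1 \<le> n \<Longrightarrow> y n \<in> {0..1}" and \<tau>: "0 < \<tau>"
  shows "((\<lambda>\<epsilon>. hausdorff_dim ({v - \<epsilon>..v + \<epsilon>} \<inter> inhom_approx_set I f y \<tau>))
    \<longlongrightarrow> 1 / (1 + ereal \<tau> * lower_exponent f v)) (at_right 0)"
proof -
  define l where "l = lower_exponent f v"
  define c where "c = 1 / (1 + ereal \<tau> * l)"
  define D where "D \<epsilon> = hausdorff_dim ({v - \<epsilon>..v + \<epsilon>} \<inter> inhom_approx_set I f y \<tau>)" for \<epsilon>
  have l0: "0 \<le> l" using lower_exponent_nonneg[OF v] by (simp add: l_def)
  have c_real: "c = ereal (1 / (1 + \<tau> * x))" if "l = ereal x" for x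
    using that l0 \<tau> by (simp add: c_def one_ereal_def divide_ereal_def add_nonneg_eq_0_iff inverse_eq_divide)
  have c0: "0 \<le> c"
    using l0 c_real \<tau> by (cases l) (auto simp: c_def)
  have lower: "c \<le> D \<epsilon>" if \<epsilon>: "0 < \<epsilon>" for \<epsilon>
  proof (rule ccontr)
    assume "\<not> c \<le> D \<epsilon>"
    then obtain s where s: "D \<epsilon> < ereal s" "ereal s < c"
      using ereal_dense2 by (auto simp: not_le)
    have "0 \<le> D \<epsilon>"
      unfolding D_def hausdorff_dim_def by (rule Inf_greatest) auto
    then have s0: "0 < s" using s(1) by (metis ereal_less(2) le_less_trans)
    have "l \<noteq> \<infinity>" using s s0 \<tau> by (auto simp: c_def)
    then obtain x where x: "l = ereal x" "0 \<le> x" using l0 by (cases l) auto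
    have pos: "0 < 1 + \<tau> * x" using x \<tau> by (simp add: add_pos_nonneg)
    have "s < 1 / (1 + \<tau> * x)" using s(2) c_real[OF x(1)] by simp
    then have "s * (1 + \<tau> * x) < 1" using pos by (simp add: field_simps)
    \<comment> \<open>The right-hand side is the value of \<open>\<sigma>\<close> at which
      \<open>s * (1 + \<tau> * \<sigma>)\<close> equals 1, so any \<open>\<sigma>\<close> strictly
      between leaves room on both sides.\<close>
    then have "x < (1 / s - 1) / \<tau>" using s0 \<tau> by (simp add: field_simps)
    then obtain \<sigma> where \<sigma>: "x < \<sigma>" "\<sigma> < (1 / s - 1) / \<tau>" using dense by blast
    have "s * (1 + \<tau> * \<sigma>) < 1" using \<sigma>(2) s0 \<tau> by (simp add: field_simps)
    moreover have "\<exists>\<^sub>F n in sequentially. f n v \<le> deriv (f n) v powr \<sigma>"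
      using frequently_le_powr_if_lower_exponent_less[OF v] \<sigma>(1) x(1) by (simp add: l_def)
    ultimately have "ereal s \<le> D \<epsilon>"
      unfolding D_def using \<sigma>(1) x(2) by (intro hausdorff_dim_inhom_approx_ge[OF v \<tau> s0 \<epsilon>, of \<sigma>]) auto
    with s(1) show False by simp
  qed
  have upper: "\<forall>\<^sub>F \<epsilon> in at_right 0. D \<epsilon> < u" if u: "c < u" for u
  proof -
    obtain s where s: "c < ereal s" "ereal s < u" using ereal_dense2[OF u] by blast
    have s0: "0 < s" using s(1) c0 by (metis ereal_less(2) le_less_trans)
    have "ereal ((1 / s - 1) / \<tau>) < l"
    proof (cases l)
      case (real x)
      then have "0 < 1 + \<tau> * x" using l0 \<tau> by (simp add: add_pos_nonneg)
      moreover have "1 / (1 + \<tau> * x) < s" using s(1) c_real[OF real] by simp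
      ultimately have "1 < s * (1 + \<tau> * x)" by (simp add: pos_divide_less_eq)
      then have "(1 / s - 1) / \<tau> < x" using s0 \<tau> by (simp add: field_simps)
      then show ?thesis using real by simp
    qed (use l0 in auto)
    then obtain \<sigma> where \<sigma>: "(1 / s - 1) / \<tau> < \<sigma>" "ereal \<sigma> < l"
      using ereal_dense2 by force
    have "1 < s * (1 + \<tau> * \<sigma>)" using \<sigma>(1) s0 \<tau> by (simp add: field_simps)
    moreover have "\<forall>\<^sub>F n in sequentially. deriv (f n) v powr \<sigma> \<le> f n v"
      using eventually_powr_le_if_less_lower_exponent[OF v] \<sigma>(2) by (simp add: l_def)
    ultimately obtain \<epsilon>0 where \<epsilon>0: "0 < \<epsilon>0"
      and null: "hausdorff_measure s ({v - \<epsilon>0..v + \<epsilon>0} \<inter> inhom_approx_set I f y \<tau>) = 0"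
      using hausdorff_measure_inhom_approx_null[OF v _ \<tau> s0, of y \<sigma>] y by blast
    have "D \<epsilon>0 \<le> ereal s" unfolding D_def using s0 null by (intro hausdorff_dim_le) auto
    \<comment> \<open>The dimension decreases with the radius, so one good radius settles all
      smaller ones.\<close>
    moreover have "D \<epsilon> \<le> D \<epsilon>0" if "\<epsilon> < \<epsilon>0" for \<epsilon>
      unfolding D_def using that by (intro hausdorff_dim_mono) auto
    ultimately have "D \<epsilon> < u" if "\<epsilon> < \<epsilon>0" for \<epsilon>
      using s(2) that by (meson le_less_trans)
    then show ?thesis using \<epsilon>0 by (auto simp: eventually_at_right_field)
  qed
  have "(D \<longlongrightarrow> c) (at_right 0)"
  proof (rule order_tendstoI)
    fix u assume "u < c"
    then have "u < D \<epsilon>" if "0 < \<epsilon>" for \<epsilon>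
      using lower[OF that] by (rule less_le_trans)
    then show "\<forall>\<^sub>F \<epsilon> in at_right 0. u < D \<epsilon>"
      using eventually_at_right_less by (rule eventually_mono[rotated])
  qed (rule upper)
  then show ?thesis by (simp add: D_def[abs_def] c_def l_def)
qed

end

section \<open>Translation of the hypotheses and comparison of the two exponents\<close>

theorem theorem1p3:
  fixes I :: "real set"
    and f :: "nat \<Rightarrow> real \<Rightarrow> real"
    and y :: "nat \<Rightarrow> real"
  assumes "open I" and "is_interval I"
    and "\<And>n x. 1 \<le> n \<Longrightarrow> x \<in> I \<Longrightarrow> 0 < f n x"
    and "\<And>n. 1 \<le> n \<Longrightarrow> mono_on I (f n)"
    and "\<And>n. 1 \<le> n \<Longrightarrow> f n C1_differentiable_on I"
    and "\<And>n x. 1 \<le> n \<Longrightarrow> x \<in> I \<Longrightarrow> 1 < f n x"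
    and "\<And>n x. 1 \<le> n \<Longrightarrow> x \<in> I \<Longrightarrow> 1 < deriv (f n) x"
    and "\<And>n. 1 \<le> n \<Longrightarrow> y n \<in> {0..1}"
    and cond_i:
      "((\<lambda>r. limsup (\<lambda>n. SUP (x, x') \<in> {(x, x'). x \<in> I \<and> x' \<in> I \<and> \<bar>x - x'\<bar> < r}.
                ereal (ln (deriv (f n) x) / ln (deriv (f n) x')))) \<longlongrightarrow> 1) (at_right 0)"
    and cond_iii:
      "\<And>x \<epsilon>. x \<in> I \<Longrightarrow> 0 < \<epsilon> \<Longrightarrow> summable (\<lambda>n. deriv (f (Suc n)) x powr (- \<epsilon>))"
  shows
    "((\<forall>v\<in>I. (SUP n\<in>{1..}. ereal (ln (deriv (f (Suc n)) v) / ln (deriv (f n) v))) < \<infinity>) \<longrightarrow>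
        (\<forall>v\<in>I. \<forall>\<tau>>1. \<exists>L.
           ((\<lambda>\<epsilon>. hausdorff_dim ({v - \<epsilon>..v + \<epsilon>} \<inter> inhom_approx_set I f y \<tau>)) \<longlongrightarrow> L) (at_right 0) \<and>
           1 / (1 + ereal \<tau> * upper_exponent f v) \<le> L \<and>
           L \<le> 1 / (1 + ereal \<tau> * lower_exponent f v)))
     \<and>
     ((\<exists>a b. \<forall>n\<ge>1. \<forall>x\<in>I. f n x = a n * x + b n) \<longrightarrow>
        (\<forall>v\<in>I. \<forall>\<tau>>1. \<exists>L.
           ((\<lambda>\<epsilon>. hausdorff_dim ({v - \<epsilon>..v + \<epsilon>} \<inter> inhom_approx_set I f y \<tau>)) \<longlongrightarrow> L) (at_right 0) \<and>
           1 / (1 + ereal \<tau> * upper_exponent f v) \<le> L \<and>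
           L \<le> 1 / (1 + ereal \<tau> * lower_exponent f v) \<and>
           L = 1 / (1 + ereal \<tau> * lower_exponent f v)))"
proof -
  have open_I: "open I" and gt1: "\<And>n x. 1 \<le> n \<Longrightarrow> x \<in> I \<Longrightarrow> 1 < f n x"
    and dgt1: "\<And>n x. 1 \<le> n \<Longrightarrow> x \<in> I \<Longrightarrow> 1 < deriv (f n) x"
    and C1: "\<And>n. 1 \<le> n \<Longrightarrow> f n C1_differentiable_on I"
    and y: "\<And>n. 1 \<le> n \<Longrightarrow> y n \<in> {0..1}"
    using assms by blast+
  interpret expanding_family I f
  proof
    show "open I" "\<And>n x. 1 \<le> n \<Longrightarrow> x \<in> I \<Longrightarrow> 1 < f n x"
      "\<And>n x. 1 \<le> n \<Longrightarrow> x \<in> I \<Longrightarrow> 1 < deriv (f n) x"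
      by (fact open_I gt1 dgt1)+
    show "(f n has_real_derivative deriv (f n) x) (at x)" if "1 \<le> n" "x \<in> I" for n x
    proof -
      from C1[OF that(1)] that(2) obtain D where "(f n has_vector_derivative D) (at x)"
        unfolding C1_differentiable_on_def by blast
      then have "(f n has_real_derivative D) (at x)"
        by (simp add: has_real_derivative_iff_has_vector_derivative)
      then show ?thesis using DERIV_imp_deriv by metis
    qed
    show "\<exists>r>0. \<forall>\<^sub>F n in sequentially. \<forall>x\<in>I. \<forall>x'\<in>I. \<bar>x - x'\<bar> < r \<longrightarrow>
        ln (deriv (f n) x) / ln (deriv (f n) x') < 1 + \<delta>" if \<delta>: "0 < \<delta>" for \<delta>
    proof -
      have "1 < ereal (1 + \<delta>)" using \<delta> by simp
      from order_tendstoD(2)[OF cond_i this] obtain r where r: "0 < r"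
        and "limsup (\<lambda>n. SUP (x, x') \<in> {(x, x'). x \<in> I \<and> x' \<in> I \<and> \<bar>x - x'\<bar> < r}.
                ereal (ln (deriv (f n) x) / ln (deriv (f n) x'))) < ereal (1 + \<delta>)"
        unfolding eventually_at_right_field by (meson dense)
      from Limsup_lessD[OF this(2)]
      have "\<forall>\<^sub>F n in sequentially. \<forall>x\<in>I. \<forall>x'\<in>I. \<bar>x - x'\<bar> < r \<longrightarrow>
        ln (deriv (f n) x) / ln (deriv (f n) x') < 1 + \<delta>"
      proof eventually_elim
        case (elim n)
        show ?case
        proof (intro ballI impI)
          fix x x' assume "x \<in> I" "x' \<in> I" "\<bar>x - x'\<bar> < r"
          then have "ereal (ln (deriv (f n) x) / ln (deriv (f n) x')) \<le>
            (SUP (x, x') \<in> {(x, x'). x \<in> I \<and> x' \<in> I \<and> \<bar>x - x'\<bar> < r}.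
                ereal (ln (deriv (f n) x) / ln (deriv (f n) x')))"
            by (intro SUP_upper2[of "(x, x')"]) auto
          from le_less_trans[OF this elim]
          show "ln (deriv (f n) x) / ln (deriv (f n) x') < 1 + \<delta>" by simp
        qed
      qed
      with r show ?thesis by blast
    qed
    \<comment> \<open>Condition (iii) sums from index 1; the additional term at index 0 does not
      affect convergence.\<close>
    show "summable (\<lambda>n. deriv (f n) x powr (- \<epsilon>))" if "x \<in> I" "0 < \<epsilon>" for x \<epsilon>
      using cond_iii[OF that] by (subst (asm) summable_Suc_iff)
  qed
  \<comment> \<open>The limit is the right-hand value. The left-hand bound follows from the order of
    the two exponents, since inversion is antitone on nonnegative extended reals, infinity
    included.\<close>
  have main: "\<exists>L. ((\<lambda>\<epsilon>. hausdorff_dim ({v - \<epsilon>..v + \<epsilon>} \<inter> inhom_approx_set I f y \<tau>)) \<longlongrightarrow> L) (at_right 0) \<and>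
      1 / (1 + ereal \<tau> * upper_exponent f v) \<le> L \<and>
      L \<le> 1 / (1 + ereal \<tau> * lower_exponent f v) \<and>
      L = 1 / (1 + ereal \<tau> * lower_exponent f v)" if v: "v \<in> I" and \<tau>: "1 < \<tau>" for v \<tau>
  proof -
    have "lower_exponent f v \<le> upper_exponent f v"
      unfolding lower_exponent_def upper_exponent_def by (rule Liminf_le_Limsup) simp
    then have "1 + ereal \<tau> * lower_exponent f v \<le> 1 + ereal \<tau> * upper_exponent f v"
      using \<tau> by (intro add_left_mono ereal_mult_left_mono) auto
    moreover have "0 \<le> 1 + ereal \<tau> * lower_exponent f v"
      using lower_exponent_nonneg[OF v] \<tau> by simp
    ultimately have "1 / (1 + ereal \<tau> * upper_exponent f v) \<le> 1 / (1 + ereal \<tau> * lower_exponent f v)"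
      by (simp add: divide_ereal_def ereal_inverse_antimono)
    then show ?thesis using local_dim_inhom_approx[OF v, of y \<tau>] y \<tau> by auto
  qed
  then show ?thesis by blast
qed

end
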